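(* For every $n\ge1$ the cyclohedra and associahedra satisfy $$\gamma(Cy^n)=\gamma(Cy^{n-1})+2\tau\sum_{i=1}^{n-1}\gamma(As^{i-1})\,\gamma(Cy^{n-i-1}),$$ $$H(Cy^n)=(\alpha+t)H(Cy^{n-1})+2\alpha t\sum_{i=1}^{n-1}H(As^{i-1})\,H(Cy^{n-i-1}).$$
   Context: Notation: $[m]=\{1,\ldots,m\}$. For a simple graph $\Gamma$ on $[n+1]$, $B(\Gamma)$ is the collection of nonempty $S\subseteq[n+1]$ such that the induced subgraph $\Gamma|_S$ is connected. The graph-associahedron is the Minkowski sum $P_\Gamma=\sum_{S\in B(\Gamma)}\mathrm{conv}\{e_i : i\in S\}\subset\mathbb{R}^{n+1}$, with $e_i$ the standard basis vectors; for connected $\Gamma$ it is a simple polytope of dimension $n$. The associahedron is $As^n=P_{L_{n+1}}$, where $L_{n+1}$ is the path graph on $[n+1]$. The cyclohedron is $Cy^n=P_{C_{n+1}}$, where $C_{n+1}$ is the cycle graph on $[n+1]$; here $C_1$ is a single node and $C_2$ is a single edge, so $Cy^0$ is a point and $Cy^1$ is an interval. For a $d$-dimensional simple polytope $P$, let $f_i$ be the number of its $i$-dimensional faces ($f_d=1$), $F(P)(\alpha,t)=\sum_{i=0}^d f_i\alpha^i t^{d-i}$ and $H(P)(\alpha,t)=F(P)(\alpha-t,t)$. By the Dehn–Sommerville equations $H(P)$ is symmetric, so it is uniquely written as $H(P)=\sum_{i=0}^{\lfloor d/2\rfloor}\gamma_i(\alpha t)^i(\alpha+t)^{d-2i}$;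 the $\gamma$-polynomial is $\gamma(P)(\tau)=\sum_{i=0}^{\lfloor d/2\rfloor}\gamma_i\tau^i$. For a point, $H=\gamma=1$. Empty sums are $0$. *)

theory Defs
  imports "HOL-Analysis.Analysis" "HOL-Analysis.Finite_Function_Topology"
    "HOL-Computational_Algebra.Polynomial"
begin

(* A simple graph is given by a vertex set and a set E of two-element edges {i, j}. *)

definition induced_connected :: "nat set set \<Rightarrow> nat set \<Rightarrow> bool" where
  "induced_connected E S \<longleftrightarrow>
     (\<forall>u\<in>S. \<forall>v\<in>S. (u, v) \<in> {(x, y). x \<in> S \<and> y \<in> S \<and> {x, y} \<in> E}\<^sup>*)"

definition building_set :: "nat set \<Rightarrow> nat set set \<Rightarrow> nat set set" where
  "building_set V E = {S. S \<noteq> {} \<and> S \<subseteq> V \<and> induced_connected E S}"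

(* The path on {1..m}, and the cycle on {1..m}.  For m = 1 the cycle is a single node and
   for m = 2 a single edge, so the closing edge {m, 1} is only added from m = 3 on. *)

definition path_edges :: "nat \<Rightarrow> nat set set" where
  "path_edges m = {{i, i + 1} | i. 1 \<le> i \<and> i < m}"

definition cycle_edges :: "nat \<Rightarrow> nat set set" where
  "cycle_edges m = path_edges m \<union> (if m \<ge> 3 then {{m, 1}} else {})"

(* Polytopes of all dimensions live in one space: the finitely supported functions
   nat \<Rightarrow> real.  R^m is the subspace of functions supported in {1..m}, the standard
   basis vector e_i is Poly_Mapping.single i 1, and faces and dimensions of a polytope
   do not depend on the ambient space.  The outer sum below is the Minkowski sum of
   HOL-Library.Set_Algebras. *)

definition graph_associahedron :: "nat set \<Rightarrow> nat set set \<Rightarrow> (nat \<Rightarrow>\<^sub>0 real) set" where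
  "graph_associahedron V E =
     (\<Sum>S\<in>building_set V E. convex hull ((\<lambda>i. Poly_Mapping.single i 1) ` S))"

definition associahedron :: "nat \<Rightarrow> (nat \<Rightarrow>\<^sub>0 real) set" where
  "associahedron n = graph_associahedron {1..n + 1} (path_edges (n + 1))"

definition cyclohedron :: "nat \<Rightarrow> (nat \<Rightarrow>\<^sub>0 real) set" where
  "cyclohedron n = graph_associahedron {1..n + 1} (cycle_edges (n + 1))"

(* The dimension of the affine hull of a nonempty set, as the dimension of its direction
   space; the library's aff_dim is restricted to class euclidean_space. *)

definition affine_dimension :: "'a::real_vector set \<Rightarrow> nat" where
  "affine_dimension A = dim {x - y | x y. x \<in> A \<and> y \<in> A}"

definition face_number :: "'a::real_vector set \<Rightarrow> nat \<Rightarrow> nat" where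
  "face_number P i = card {F. F face_of P \<and> F \<noteq> {} \<and> affine_dimension F = i}"

definition F_poly :: "'a::real_vector set \<Rightarrow> 'r::comm_ring_1 \<Rightarrow> 'r \<Rightarrow> 'r" where
  "F_poly P a t =
     (\<Sum>i\<le>affine_dimension P. of_nat (face_number P i) * a ^ i * t ^ (affine_dimension P - i))"

(* The polynomial ring Z[alpha, t] is represented as Z[t][alpha]. *)

definition var_alpha :: "int poly poly" where
  "var_alpha = [:0, 1:]"

definition var_t :: "int poly poly" where
  "var_t = [:[:0, 1:]:]"

definition H_poly :: "'a::real_vector set \<Rightarrow> int poly poly" where
  "H_poly P = F_poly P (var_alpha - var_t) var_t"

(* The coefficients gamma_i are integers: the leading term in alpha of
   (alpha t)^i (alpha + t)^(d - 2 i) is alpha^(d - i) t^i, with coefficient 1, so they are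
   determined successively over the integers. *)

definition gamma_poly :: "'a::real_vector set \<Rightarrow> int poly" where
  "gamma_poly P =
     (THE g. degree g \<le> affine_dimension P div 2 \<and>
        H_poly P = (\<Sum>i\<le>affine_dimension P div 2.
          of_int (coeff g i) * (var_alpha * var_t) ^ i
            * (var_alpha + var_t) ^ (affine_dimension P - 2 * i)))"

end

theory Submission
  imports Defs
begin

text \<open>
  The nonempty faces of the graph-associahedron of a connected graph on \<open>V\<close> correspond to the nested
  collections \<open>N\<close> of connected vertex sets with \<open>V \<in> N\<close>, and the face of \<open>N\<close> has dimension
  \<open>card V - card N\<close>. The polytope is described by its points, written as sums of one point from each
  simplex (a plan). For a connected set \<open>K\<close>, the total coordinate mass on \<open>K\<close> is at least the number of
  simplices inside \<open>K\<close>. The face of \<open>N\<close> is where this bound is attained for all \<open>K \<in> N\<close>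
  (\<open>face_points_eq\<close>), and conversely the sets whose bound is attained on a given face form a nested
  collection (\<open>tight_nests\<close>) which determines the face (\<open>face_points_tight\<close>).

  Hence F is a weighted count of nested collections. Removing the member \<open>V\<close> leaves a nonempty set of
  uncovered vertices; deleting vertices from it cuts a path into two paths and a cycle into one or two
  arcs, and the collection splits accordingly. For a path this is applied to the first uncovered
  vertex, for a cycle to the smallest and the largest one. For the generating functions \<open>A\<close> and \<open>C\<close> of
  the paths and cycles, indexed by the number of vertices, with \<open>B = 1 + t A\<close>, \<open>U = 1 + (a + t) A\<close>, this says
  \<open>A = X B U\<close> and \<open>C = X (X B)' (1 + a X U)\<close>, where the derivative counts the positions of the covered arc
  relative to the closing edge of the cycle. Putting \<open>a = \<alpha> - t\<close> passes from F to H. Differentiating the equation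
  for \<open>A\<close> eliminates the derivative and yields
  \<open>C = X + (\<alpha> + t) X C + 2 \<alpha> t X A C\<close> (\<open>cycle_equation\<close>), which is the recursion for H.

  The recursion for the gamma polynomials follows because the assignment of gamma polynomials is
  additive and multiplicative, sends \<open>\<alpha> + t\<close> to 1 and \<open>\<alpha> t\<close> to \<open>\<tau>\<close>, and is single-valued
  (\<open>gamma_expansion_eq_0\<close>). That the associahedra and cyclohedra have gamma polynomials at all is
  read off from the recursions for H.
\<close>

section \<open>Connected sets and nested collections\<close>

lemma reachable_inside_sym:
  assumes "(u, v) \<in> {(x, y). x \<in> S \<and> y \<in> S \<and> {x, y} \<in> E}\<^sup>*"
  shows "(v, u) \<in> {(x, y). x \<in> S \<and> y \<in> S \<and> {x, y} \<in> E}\<^sup>*"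
proof -
  have "sym {(x, y). x \<in> S \<and> y \<in> S \<and> {x, y} \<in> E}"
    by (auto simp: sym_def insert_commute)
  then show ?thesis
    using assms by (meson sym_rtrancl symD)
qed

lemma reachable_inside_mono:
  assumes "(u, v) \<in> {(x, y). x \<in> S \<and> y \<in> S \<and> {x, y} \<in> E}\<^sup>*" "S \<subseteq> S'"
  shows "(u, v) \<in> {(x, y). x \<in> S' \<and> y \<in> S' \<and> {x, y} \<in> E}\<^sup>*"
  by (rule rtrancl_mono[THEN subsetD, OF _ assms(1)]) (use assms(2) in auto)

lemma induced_connectedI:
  assumes "\<And>v. v \<in> S \<Longrightarrow> (r, v) \<in> {(x, y). x \<in> S \<and> y \<in> S \<and> {x, y} \<in> E}\<^sup>*"
  shows "induced_connected E S"
  unfolding induced_connected_def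
proof (intro ballI)
  fix u v assume "u \<in> S" "v \<in> S"
  then show "(u, v) \<in> {(x, y). x \<in> S \<and> y \<in> S \<and> {x, y} \<in> E}\<^sup>*"
    using rtrancl_trans[OF reachable_inside_sym[OF assms] assms] by simp
qed

lemma induced_connected_Un:
  assumes "induced_connected E K" "induced_connected E L"
    and uv: "u \<in> K" "v \<in> L" "u = v \<or> {u, v} \<in> E"
  shows "induced_connected E (K \<union> L)"
proof (rule induced_connectedI[of _ u])
  let ?R = "\<lambda>S. {(x, y). x \<in> S \<and> y \<in> S \<and> {x, y} \<in> E}"
  fix w assume w: "w \<in> K \<union> L"
  have uK: "(u, w) \<in> (?R (K \<union> L))\<^sup>*" if "w \<in> K"
    using assms(1)[unfolded induced_connected_def] that uv(1)
    by (intro reachable_inside_mono[of u w K E "K \<union> L"]) auto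
  have uv': "(u, v) \<in> (?R (K \<union> L))\<^sup>*"
    using uv by (cases "u = v") auto
  have "(v, w) \<in> (?R (K \<union> L))\<^sup>*" if "w \<in> L"
    using assms(2)[unfolded induced_connected_def] that uv(2)
    by (intro reachable_inside_mono[of v w L E "K \<union> L"]) auto
  then have "(u, w) \<in> (?R (K \<union> L))\<^sup>*" if "w \<in> L"
    using rtrancl_trans[OF uv'] that by blast
  then show "(u, w) \<in> (?R (K \<union> L))\<^sup>*" using w uK by blast
qed

lemma crossing_edge:
  assumes "induced_connected E C" "u \<in> C \<inter> S" "w \<in> C - S"
  obtains x y where "x \<in> C \<inter> S" "y \<in> C - S" "{x, y} \<in> E"
proof -
  have "(u, w) \<in> {(x, y). x \<in> C \<and> y \<in> C \<and> {x, y} \<in> E}\<^sup>*"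
    using assms(1)[unfolded induced_connected_def, rule_format, of u w] assms(2,3) by simp
  then have "w \<notin> S \<longrightarrow> (\<exists>x\<in>C \<inter> S. \<exists>y\<in>C - S. {x, y} \<in> E)"
  proof (induction rule: rtrancl_induct)
    case base
    then show ?case using assms(2) by blast
  next
    case (step y z)
    then show ?case by (cases "y \<in> S") auto
  qed
  then show ?thesis using assms(3) that by auto
qed

text \<open>
  Two overlapping connected sets have a connected union, so for connected sets the condition says
  that two members are comparable or disjoint without an edge between them: these are the tubings
  of the graph.
\<close>

definition nested :: "nat set set \<Rightarrow> nat set set \<Rightarrow> bool" where
  "nested E N \<longleftrightarrow> (\<forall>K\<in>N. \<forall>L\<in>N. K \<subseteq> L \<or> L \<subseteq> K \<or> \<not> induced_connected E (K \<union> L))"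

text \<open>
  A collection may leave vertices of \<open>V\<close> uncovered, since the counting below repeatedly deletes
  the uncovered vertices and restricts to what remains.
\<close>

definition nested_collections :: "nat set set \<Rightarrow> nat set \<Rightarrow> nat set set set" where
  "nested_collections E V = {N. N \<subseteq> building_set V E \<and> nested E N}"

text \<open>
  For a member \<open>S\<close> of \<open>N\<close> this is \<open>S\<close> without the smaller members. The same formula, for an
  arbitrary \<open>S\<close>, gives the vertex set of the face that the simplex on \<open>S\<close> contributes to the face of
  the polytope belonging to \<open>N\<close>.
\<close>

definition top_part :: "nat set set \<Rightarrow> nat set \<Rightarrow> nat set" where
  "top_part N S = {i \<in> S. \<forall>K\<in>N. i \<in> K \<longrightarrow> S \<subseteq> K}"

lemma finite_building_set: "finite V \<Longrightarrow> finite (building_set V E)"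
  by (rule finite_subset[of _ "Pow V"]) (auto simp: building_set_def)

lemma finite_nested_collections: "finite V \<Longrightarrow> finite (nested_collections E V)"
  by (rule finite_subset[of _ "Pow (building_set V E)"])
     (auto simp: nested_collections_def finite_building_set)

lemma nested_collectionsD:
  assumes "N \<in> nested_collections E V"
  shows "nested E N" "\<And>K. K \<in> N \<Longrightarrow> induced_connected E K" "\<And>K. K \<in> N \<Longrightarrow> K \<noteq> {}"
    "\<And>K. K \<in> N \<Longrightarrow> K \<subseteq> V" "N \<subseteq> building_set V E" "\<Union>N \<subseteq> V"
    "finite V \<Longrightarrow> finite N"
proof -
  show "finite N" if "finite V"
    using finite_subset[of N, OF _ finite_building_set[OF that]] assms
    unfolding nested_collections_def by blast
qed (use assms in \<open>auto simp: nested_collections_def building_set_def\<close>)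

lemma nested_meet:
  assumes "N \<in> nested_collections E V" "K \<in> N" "L \<in> N" "i \<in> K" "i \<in> L"
  shows "K \<subseteq> L \<or> L \<subseteq> K"
proof -
  have "induced_connected E (K \<union> L)"
    using induced_connected_Un[of E K L i i] nested_collectionsD(2)[OF assms(1)] assms(2-5) by simp
  then show ?thesis
    using nested_collectionsD(1)[OF assms(1)] assms(2,3) unfolding nested_def by blast
qed

text \<open>
  A maximal member \<open>K\<close> meeting \<open>C\<close> contains \<open>C\<close>: otherwise some edge of \<open>C\<close> leaves \<open>K\<close>, its other end
  lies in a member \<open>L\<close>, and \<open>K \<union> L\<close> is connected, so that \<open>L\<close> is comparable with \<open>K\<close>, against maximality.
\<close>

lemma connected_covered_subset:
  assumes N: "N \<in> nested_collections E V" "finite V"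
    and C: "induced_connected E C" "C \<noteq> {}" "C \<subseteq> \<Union>N"
  obtains K where "K \<in> N" "C \<subseteq> K"
proof -
  note D = nested_collectionsD[OF N(1)]
  have "finite {K\<in>N. K \<inter> C \<noteq> {}}" using D(7)[OF N(2)] by auto
  moreover have "{K\<in>N. K \<inter> C \<noteq> {}} \<noteq> {}" using C by blast
  ultimately obtain K where K: "K \<in> N" "K \<inter> C \<noteq> {}"
    and max: "\<And>L. L \<in> N \<Longrightarrow> L \<inter> C \<noteq> {} \<Longrightarrow> K \<subseteq> L \<Longrightarrow> K = L"
    using finite_has_maximal[of "{K\<in>N. K \<inter> C \<noteq> {}}"] by auto
  have "C \<subseteq> K"
  proof (rule ccontr)
    assume "\<not> C \<subseteq> K"
    then obtain u w where "u \<in> C \<inter> K" "w \<in> C - K" using K(2) by blast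
    from crossing_edge[OF C(1) this] obtain x y
      where xy: "x \<in> C \<inter> K" "y \<in> C - K" "{x, y} \<in> E" .
    obtain L where L: "L \<in> N" "y \<in> L" using xy(2) C(3) by blast
    have "induced_connected E (K \<union> L)"
      using induced_connected_Un[of E K L x y] D(2) K(1) L xy by blast
    then have "K \<subseteq> L \<or> L \<subseteq> K" using D(1) K(1) L(1) unfolding nested_def by blast
    then show False using max[OF L(1)] L(2) xy(2) by blast
  qed
  then show ?thesis using K that by blast
qed

text \<open>
  Otherwise the members of \<open>N\<close> that do not contain \<open>S\<close> would cover \<open>S\<close>, and then one of them would
  contain it.
\<close>

lemma top_part_nonempty:
  assumes N: "N \<in> nested_collections E V" "finite V"
    and S: "induced_connected E S" "S \<noteq> {}"
  shows "top_part N S \<noteq> {}"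
proof
  assume empty: "top_part N S = {}"
  let ?N = "{K\<in>N. \<not> S \<subseteq> K}"
  have "?N \<in> nested_collections E V"
    using N(1) by (auto simp: nested_collections_def nested_def)
  moreover have "S \<subseteq> \<Union>?N" using empty by (auto simp: top_part_def)
  ultimately obtain K where "K \<in> ?N" "S \<subseteq> K"
    using connected_covered_subset[OF _ N(2) S] by blast
  then show False by blast
qed

lemma top_part_disjoint:
  assumes "K \<in> N" "L \<in> N" "i \<in> top_part N K" "i \<in> top_part N L"
  shows "K = L"
  using assms unfolding top_part_def by blast

text \<open>
  The top parts of the members are nonempty and pairwise disjoint, so one vertex can be chosen from
  each.
\<close>

lemma card_nested_le:
  assumes N: "N \<in> nested_collections E V" "finite V"
  shows "card N \<le> card (\<Union>N)"
proof -
  note D = nested_collectionsD[OF N(1)]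
  define r where "r K = (SOME i. i \<in> top_part N K)" for K
  have r: "r K \<in> top_part N K" if "K \<in> N" for K
    using top_part_nonempty[OF N D(2)[OF that] D(3)[OF that]]
    unfolding r_def by (simp add: some_in_eq)
  show ?thesis
  proof (rule card_inj_on_le[of r])
    show "inj_on r N" by (rule inj_onI) (metis r top_part_disjoint)
    show "r ` N \<subseteq> \<Union>N" using r by (auto simp: top_part_def)
    show "finite (\<Union>N)" using D(6) N(2) by (rule finite_subset)
  qed
qed

text \<open>
  The smallest member containing \<open>S\<close> has the required property.
\<close>

lemma top_part_subset_block:
  assumes N: "N \<in> nested_collections E V" "finite V"
    and S: "V \<in> N" "S \<subseteq> V"
  obtains C where "C \<in> N" "top_part N S \<subseteq> top_part N C" "S \<subseteq> C"
proof -
  note D = nested_collectionsD[OF N(1)]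
  have "finite {K\<in>N. S \<subseteq> K}" using D(7)[OF N(2)] by auto
  moreover have "{K\<in>N. S \<subseteq> K} \<noteq> {}" using S by blast
  ultimately obtain C where C: "C \<in> N" "S \<subseteq> C"
    and min: "\<And>L. L \<in> N \<Longrightarrow> S \<subseteq> L \<Longrightarrow> L \<subseteq> C \<Longrightarrow> C = L"
    using finite_has_minimal[of "{K\<in>N. S \<subseteq> K}"] by auto
  have "top_part N S \<subseteq> top_part N C"
  proof
    fix i assume i: "i \<in> top_part N S"
    show "i \<in> top_part N C"
      unfolding top_part_def
    proof (intro CollectI conjI ballI impI)
      show "i \<in> C" using i C(2) by (auto simp: top_part_def)
      fix K assume K: "K \<in> N" "i \<in> K"
      then have "S \<subseteq> K" using i by (auto simp: top_part_def)
      moreover have "K \<subseteq> C \<or> C \<subseteq> K" using nested_meet[OF N(1) K(1) C(1) K(2) \<open>i \<in> C\<close>] .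
      ultimately show "C \<subseteq> K" using min[OF K(1)] by blast
    qed
  qed
  then show ?thesis using C that by blast
qed

section \<open>Points of a Minkowski sum of simplices\<close>

abbreviation basis_vector :: "nat \<Rightarrow> (nat \<Rightarrow>\<^sub>0 real)" where
  "basis_vector i \<equiv> Poly_Mapping.single i 1"

text \<open>
  A point of a Minkowski sum of simplices is a sum of one point from each simplex; \<open>c S i\<close> is the
  barycentric coordinate at \<open>i\<close> of the point chosen in the simplex on \<open>S\<close>. Only the values with
  \<open>i \<in> S\<close> and \<open>S \<in> B\<close> matter. Working with plans rather than points makes faces visible: a face is
  described by the entries that must vanish.
\<close>

definition plan :: "nat set set \<Rightarrow> (nat set \<Rightarrow> nat \<Rightarrow> real) \<Rightarrow> bool" where
  "plan B c \<longleftrightarrow> (\<forall>S\<in>B. (\<forall>i\<in>S. 0 \<le> c S i) \<and> (\<Sum>i\<in>S. c S i) = 1)"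

definition point :: "nat set set \<Rightarrow> (nat set \<Rightarrow> nat \<Rightarrow> real) \<Rightarrow> (nat \<Rightarrow>\<^sub>0 real)" where
  "point B c = (\<Sum>S\<in>B. \<Sum>i\<in>S. c S i *\<^sub>R basis_vector i)"

definition mass :: "nat set \<Rightarrow> (nat \<Rightarrow>\<^sub>0 real) \<Rightarrow> real" where
  "mass K x = (\<Sum>i\<in>K. Poly_Mapping.lookup x i)"

lemma lookup_scaleR:
  fixes x :: "nat \<Rightarrow>\<^sub>0 real"
  shows "Poly_Mapping.lookup (a *\<^sub>R x) j = a * Poly_Mapping.lookup x j"
  by (simp add: scaleR_poly_mapping_def lookup_Abs_poly_mapping)

lemma convex_hull_basis_vectors:
  assumes "finite S"
  shows "convex hull (basis_vector ` S) =
    (\<lambda>u. \<Sum>i\<in>S. u i *\<^sub>R basis_vector i) ` {u. (\<forall>i\<in>S. 0 \<le> u i) \<and> (\<Sum>i\<in>S. u i) = 1}"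
proof -
  have inj: "inj_on basis_vector S"
    by (rule inj_onI) (metis lookup_single_eq lookup_single_not_eq zero_neq_one)
  show ?thesis (is "_ = ?R")
  proof (rule set_eqI, rule iffI)
    fix x assume "x \<in> convex hull (basis_vector ` S)"
    then obtain u where u: "\<forall>v\<in>basis_vector ` S. 0 \<le> u v" "sum u (basis_vector ` S) = 1"
      "(\<Sum>v\<in>basis_vector ` S. u v *\<^sub>R v) = x"
      using assms by (auto simp: convex_hull_finite)
    then show "x \<in> ?R"
      by (intro image_eqI[of _ _ "\<lambda>i. u (basis_vector i)"]) (auto simp: sum.reindex[OF inj])
  next
    fix x assume "x \<in> ?R"
    then obtain u where u: "\<forall>i\<in>S. 0 \<le> u i" "(\<Sum>i\<in>S. u i) = (1::real)"
      "x = (\<Sum>i\<in>S. u i *\<^sub>R basis_vector i)" by auto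
    show "x \<in> convex hull (basis_vector ` S)"
      unfolding u(3) by (rule convex_sum) (use assms u(1,2) in \<open>auto intro!: hull_inc\<close>)
  qed
qed

lemma Minkowski_sum_of_simplices:
  assumes "finite B" "\<And>S. S \<in> B \<Longrightarrow> finite S"
  shows "(\<Sum>S\<in>B. convex hull (basis_vector ` S)) = point B ` {c. plan B c}"
proof -
  let ?Q = "\<lambda>S u. (\<forall>i\<in>S. 0 \<le> u i) \<and> (\<Sum>i\<in>S. u i) = (1::real)"
  let ?p = "\<lambda>S u. \<Sum>i\<in>S. u i *\<^sub>R basis_vector i"
  have "(\<Sum>S\<in>B. convex hull (basis_vector ` S))
      = {sum s B |s. \<forall>S\<in>B. s S \<in> ?p S ` {u. ?Q S u}}"
    using convex_hull_basis_vectors[OF assms(2)] by (simp add: set_sum_alt[OF assms(1)])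
  also have "\<dots> = point B ` {c. plan B c}"
  proof (intro subset_antisym subsetI)
    fix x assume "x \<in> {sum s B |s. \<forall>S\<in>B. s S \<in> ?p S ` {u. ?Q S u}}"
    then obtain s where s: "x = sum s B" "\<forall>S\<in>B. s S \<in> ?p S ` {u. ?Q S u}" by blast
    from s(2) have "\<forall>S\<in>B. \<exists>u. ?Q S u \<and> s S = ?p S u" by blast
    from bchoice[OF this] obtain c where c: "\<forall>S\<in>B. ?Q S (c S) \<and> s S = ?p S (c S)" by blast
    then have "plan B c" "x = point B c" using s(1) by (simp_all add: point_def plan_def)
    then show "x \<in> point B ` {c. plan B c}" by blast
  next
    fix x assume "x \<in> point B ` {c. plan B c}"
    then obtain c where c: "plan B c" "x = point B c" by auto
    then have "x = sum (\<lambda>S. ?p S (c S)) B \<and> (\<forall>S\<in>B. ?p S (c S) \<in> ?p S ` {u. ?Q S u})"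
      by (simp add: plan_def point_def)
    then show "x \<in> {sum s B |s. \<forall>S\<in>B. s S \<in> ?p S ` {u. ?Q S u}}" by blast
  qed
  finally show ?thesis .
qed

lemma point_affine_combination:
  "u *\<^sub>R point B c + v *\<^sub>R point B d = point B (\<lambda>S i. u * c S i + v * d S i)"
  by (simp add: point_def scaleR_sum_right scaleR_add_left sum.distrib)

lemma plan_affine_combination_sum:
  assumes "plan B c" "plan B d" "u + v = 1" "S \<in> B"
  shows "(\<Sum>i\<in>S. u * c S i + v * d S i) = 1"
  using assms by (simp add: plan_def sum.distrib flip: sum_distrib_left)

lemma plan_convex_combination:
  assumes "plan B c" "plan B d" "0 \<le> u" "0 \<le> v" "u + v = 1"
  shows "plan B (\<lambda>S i. u * c S i + v * d S i)"
  using assms plan_affine_combination_sum[OF assms(1,2,5)] by (auto simp: plan_def)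

lemma lookup_point:
  assumes "finite B" "\<And>S. S \<in> B \<Longrightarrow> finite S"
  shows "Poly_Mapping.lookup (point B c) j = (\<Sum>S\<in>{S\<in>B. j \<in> S}. c S j)"
proof -
  have "Poly_Mapping.lookup (point B c) j = (\<Sum>S\<in>B. \<Sum>i\<in>S. c S i * (1 when i = j))"
    by (simp add: point_def lookup_sum lookup_scaleR lookup_single)
  also have "\<dots> = (\<Sum>S\<in>B. if j \<in> S then c S j else 0)"
  proof (rule sum.cong[OF refl])
    fix S assume "S \<in> B"
    then show "(\<Sum>i\<in>S. c S i * (1 when i = j)) = (if j \<in> S then c S j else 0)"
      using assms(2)[of S] by (simp add: when_def if_distrib cong: if_cong)
  qed
  also have "\<dots> = (\<Sum>S\<in>{S\<in>B. j \<in> S}. c S j)"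
    using assms(1) by (simp add: sum.If_cases Int_def conj_commute)
  finally show ?thesis .
qed

lemma mass_point:
  assumes "finite B" "\<And>S. S \<in> B \<Longrightarrow> finite S" "finite K"
  shows "mass K (point B c) = (\<Sum>S\<in>B. \<Sum>i\<in>S \<inter> K. c S i)"
proof -
  have "mass K (point B c) = (\<Sum>i\<in>K. \<Sum>S\<in>{S\<in>B. i \<in> S}. c S i)"
    by (simp add: mass_def lookup_point[OF assms(1,2)])
  also have "\<dots> = (\<Sum>S\<in>B. \<Sum>i\<in>{i\<in>K. i \<in> S}. c S i)"
    using sum.swap_restrict[OF assms(3,1), of "\<lambda>i S. c S i" "\<lambda>i S. i \<in> S"] by simp
  also have "\<dots> = (\<Sum>S\<in>B. \<Sum>i\<in>S \<inter> K. c S i)"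
    by (intro sum.cong) auto
  finally show ?thesis .
qed

abbreviation inside :: "nat set set \<Rightarrow> nat set \<Rightarrow> nat set set" where
  "inside B K \<equiv> {S\<in>B. S \<subseteq> K}"

text \<open>
  A simplex on a set inside \<open>K\<close> puts its whole mass 1 on \<open>K\<close>, and any other simplex puts a
  nonnegative mass there. Equality means that the other simplices avoid \<open>K\<close>.
\<close>

lemma mass_point_bound:
  assumes B: "finite B" "\<And>S. S \<in> B \<Longrightarrow> finite S" "finite K" and c: "plan B c"
  shows "card (inside B K) \<le> mass K (point B c)"
    and "mass K (point B c) = card (inside B K) \<longleftrightarrow>
          (\<forall>S\<in>B. \<forall>i\<in>S \<inter> K. \<not> S \<subseteq> K \<longrightarrow> c S i = 0)"
proof -
  let ?e = "\<Sum>S\<in>{S\<in>B. \<not> S \<subseteq> K}. \<Sum>i\<in>S \<inter> K. c S i"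
  have nonneg: "\<And>S i. S \<in> B \<Longrightarrow> i \<in> S \<Longrightarrow> 0 \<le> c S i" using c by (auto simp: plan_def)
  have "mass K (point B c) = (\<Sum>S\<in>inside B K. \<Sum>i\<in>S \<inter> K. c S i) + ?e"
  proof -
    have "B = inside B K \<union> {S\<in>B. \<not> S \<subseteq> K}" by blast
    then have "mass K (point B c) = (\<Sum>S\<in>inside B K \<union> {S\<in>B. \<not> S \<subseteq> K}. \<Sum>i\<in>S \<inter> K. c S i)"
      by (metis mass_point[OF B])
    then show ?thesis
      by (subst (asm) sum.union_disjoint) (auto simp: B(1))
  qed
  also have "(\<Sum>S\<in>inside B K. \<Sum>i\<in>S \<inter> K. c S i) = (\<Sum>S\<in>inside B K. 1)"
    using c by (intro sum.cong) (auto simp: plan_def Int_absorb2)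
  finally have split: "mass K (point B c) = card (inside B K) + ?e" by simp
  have "0 \<le> ?e" using nonneg by (intro sum_nonneg) auto
  with split show "card (inside B K) \<le> mass K (point B c)" by simp
  have "?e = 0 \<longleftrightarrow> (\<forall>S\<in>{S\<in>B. \<not> S \<subseteq> K}. (\<Sum>i\<in>S \<inter> K. c S i) = 0)"
    using nonneg B(1) by (intro sum_nonneg_eq_0_iff) (auto intro!: sum_nonneg)
  also have "\<dots> \<longleftrightarrow> (\<forall>S\<in>{S\<in>B. \<not> S \<subseteq> K}. \<forall>i\<in>S \<inter> K. c S i = 0)"
    using nonneg B(2) by (intro ball_cong refl sum_nonneg_eq_0_iff) auto
  finally show "mass K (point B c) = card (inside B K) \<longleftrightarrow>
      (\<forall>S\<in>B. \<forall>i\<in>S \<inter> K. \<not> S \<subseteq> K \<longrightarrow> c S i = 0)"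
    using split by auto
qed

lemma mass_affine: "mass K (u *\<^sub>R x + v *\<^sub>R y) = u * mass K x + v * mass K y"
  by (simp add: mass_def lookup_add lookup_scaleR sum.distrib sum_distrib_left)

lemma mass_modular:
  assumes "finite K" "finite L"
  shows "mass K x + mass L x = mass (K \<union> L) x + mass (K \<inter> L) x"
  unfolding mass_def using sum.union_inter[OF assms] by metis

lemma minimum_face_of:
  assumes "convex P" "\<And>x K. x \<in> P \<Longrightarrow> K \<in> N \<Longrightarrow> m K \<le> mass K x"
  shows "{x \<in> P. \<forall>K\<in>N. mass K x = m K} face_of P"
  unfolding face_of_def
proof (intro conjI ballI impI)
  show "convex {x \<in> P. \<forall>K\<in>N. mass K x = m K}"
    using assms(1) unfolding convex_def
    by (auto simp: mass_affine simp flip: distrib_right)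
next
  fix a b x assume ab: "a \<in> P" "b \<in> P" and x: "x \<in> {x \<in> P. \<forall>K\<in>N. mass K x = m K}"
    and "x \<in> open_segment a b"
  then obtain u where u: "0 < u" "u < 1" "x = (1 - u) *\<^sub>R a + u *\<^sub>R b"
    by (auto simp: in_segment)
  have "mass K a = m K \<and> mass K b = m K" if "K \<in> N" for K
  proof -
    have eq: "(1 - u) * (mass K a - m K) + u * (mass K b - m K) = 0"
    proof -
      have "mass K ((1 - u) *\<^sub>R a + u *\<^sub>R b) = m K" using x that by (simp add: u(3))
      then show ?thesis unfolding mass_affine by (simp add: algebra_simps)
    qed
    have "0 \<le> (1 - u) * (mass K a - m K)" "0 \<le> u * (mass K b - m K)"
      using u assms(2) ab that by auto
    then have "(1 - u) * (mass K a - m K) = 0" "u * (mass K b - m K) = 0" using eq by linarith+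
    then show ?thesis using u(1,2) by simp
  qed
  then show "a \<in> {x \<in> P. \<forall>K\<in>N. mass K x = m K}" "b \<in> {x \<in> P. \<forall>K\<in>N. mass K x = m K}"
    using ab by auto
qed auto

section \<open>The faces of a graph-associahedron\<close>

locale connected_graph =
  fixes V :: "nat set" and E :: "nat set set"
  assumes finite_V: "finite V" and V_nonempty: "V \<noteq> {}" and connected_V: "induced_connected E V"
begin

abbreviation "B \<equiv> building_set V E"
abbreviation "P \<equiv> graph_associahedron V E"

definition nests :: "nat set set set" where
  "nests = {N \<in> nested_collections E V. V \<in> N}"

text \<open>
  The zero pattern is exactly what equality in the mass bounds of all members of \<open>N\<close> forces, which
  is the content of \<open>face_points_eq\<close> below.
\<close>

definition face_points :: "nat set set \<Rightarrow> (nat \<Rightarrow>\<^sub>0 real) set" where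
  "face_points N =
     point B ` {c. plan B c \<and> (\<forall>S\<in>B. \<forall>i\<in>S. i \<notin> top_part N S \<longrightarrow> c S i = 0)}"

text \<open>
  The bounds \<open>card (inside B K) \<le> mass K x\<close> are the facet inequalities of \<open>P\<close> together with the
  equation of its affine hull (\<open>K = V\<close>), so this records the facets that contain \<open>F\<close>.
\<close>

definition tight :: "(nat \<Rightarrow>\<^sub>0 real) set \<Rightarrow> nat set set" where
  "tight F = {K \<in> B. \<forall>x\<in>F. mass K x = card (inside B K)}"

lemma V_in_B: "V \<in> B"
  using V_nonempty connected_V by (simp add: building_set_def)

lemma finite_B: "finite B"
  by (rule finite_building_set[OF finite_V])

lemma in_building_setD: "S \<in> B \<Longrightarrow> S \<subseteq> V" "S \<in> B \<Longrightarrow> S \<noteq> {}" "S \<in> B \<Longrightarrow> induced_connected E S"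
  by (auto simp: building_set_def)

lemma finite_in_B: "S \<in> B \<Longrightarrow> finite S"
  using in_building_setD(1) finite_V by (rule finite_subset)

lemma P_eq: "P = point B ` {c. plan B c}"
  unfolding graph_associahedron_def
  by (rule Minkowski_sum_of_simplices[OF finite_B finite_in_B])

lemma convex_P: "convex P"
  unfolding P_eq convex_def
  by (auto simp: point_affine_combination intro!: imageI plan_convex_combination)

lemma point_in_P: "plan B c \<Longrightarrow> point B c \<in> P"
  unfolding P_eq by blast

lemma obtain_plan:
  assumes "x \<in> P"
  obtains c where "plan B c" "x = point B c"
  using assms that unfolding P_eq by blast

lemma nestsD:
  assumes "N \<in> nests"
  shows "N \<in> nested_collections E V" "V \<in> N" "N \<subseteq> B" "finite N"
  using assms nested_collectionsD(5,7)[of N E V] finite_V by (auto simp: nests_def)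

lemma mass_bound:
  assumes "plan B c" "finite K"
  shows "card (inside B K) \<le> mass K (point B c)"
    and "mass K (point B c) = card (inside B K) \<longleftrightarrow>
          (\<forall>S\<in>B. \<forall>i\<in>S \<inter> K. \<not> S \<subseteq> K \<longrightarrow> c S i = 0)"
  using mass_point_bound[OF finite_B finite_in_B assms(2,1)] by blast+

lemma face_points_eq:
  assumes "N \<subseteq> B"
  shows "face_points N = {x \<in> P. \<forall>K\<in>N. mass K x = card (inside B K)}"
proof -
  have "(\<forall>K\<in>N. mass K (point B c) = card (inside B K)) \<longleftrightarrow>
      (\<forall>S\<in>B. \<forall>i\<in>S. i \<notin> top_part N S \<longrightarrow> c S i = 0)" if c: "plan B c" for c
  proof -
    have "(\<forall>K\<in>N. mass K (point B c) = card (inside B K)) \<longleftrightarrow>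
        (\<forall>K\<in>N. \<forall>S\<in>B. \<forall>i\<in>S \<inter> K. \<not> S \<subseteq> K \<longrightarrow> c S i = 0)"
      using mass_bound(2)[OF c finite_in_B] assms by (intro ball_cong refl) auto
    also have "\<dots> \<longleftrightarrow> (\<forall>S\<in>B. \<forall>i\<in>S. i \<notin> top_part N S \<longrightarrow> c S i = 0)"
      by (auto simp: top_part_def)
    finally show ?thesis .
  qed
  then show ?thesis unfolding face_points_def P_eq by auto
qed

lemma face_points_face_of:
  assumes "N \<subseteq> B"
  shows "face_points N face_of P"
  unfolding face_points_eq[OF assms]
  by (rule minimum_face_of[OF convex_P]) (use assms mass_bound(1) finite_in_B in \<open>auto simp: P_eq\<close>)

lemma indicator_plan:
  assumes "\<And>S. S \<in> B \<Longrightarrow> r S \<in> top_part N S"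
  shows "plan B (\<lambda>S i. if i = r S then 1 else 0)"
    and "point B (\<lambda>S i. if i = r S then 1 else 0) \<in> face_points N"
proof -
  show *: "plan B (\<lambda>S i. if i = r S then 1 else 0)"
    using assms finite_in_B by (auto simp: plan_def top_part_def)
  show "point B (\<lambda>S i. if i = r S then 1 else 0) \<in> face_points N"
    unfolding face_points_def using * assms by (intro imageI) auto
qed

lemma top_part_choice:
  assumes "N \<in> nests"
  obtains r where "\<And>S. S \<in> B \<Longrightarrow> r S \<in> top_part N S"
proof -
  have "\<forall>S\<in>B. \<exists>i. i \<in> top_part N S"
    using top_part_nonempty[OF nestsD(1)[OF assms] finite_V in_building_setD(3,2)] by blast
  from bchoice[OF this] obtain r where "\<forall>S\<in>B. r S \<in> top_part N S" ..
  then show ?thesis using that[of r] by simp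
qed

lemma face_points_nonempty:
  assumes "N \<in> nests"
  shows "face_points N \<noteq> {}"
proof -
  obtain r where "\<And>S. S \<in> B \<Longrightarrow> r S \<in> top_part N S" using top_part_choice[OF assms] by blast
  from indicator_plan(2)[OF this] show ?thesis by blast
qed

text \<open>
  Suppose \<open>K\<close> is tight and \<open>C\<close> is the smallest member of \<open>N\<close> containing \<open>K\<close>. A point of the face may
  concentrate the simplex on \<open>C\<close> at a vertex of \<open>top_part N K\<close>; if \<open>C \<noteq> K\<close>, this mass on \<open>K\<close> comes from
  a set that is not inside \<open>K\<close>, and \<open>K\<close> is not tight.
\<close>

lemma tight_face_points:
  assumes N: "N \<in> nests"
  shows "tight (face_points N) = N"
proof
  show "N \<subseteq> tight (face_points N)"
    unfolding tight_def using nestsD(3)[OF N] face_points_eq[OF nestsD(3)[OF N]] by auto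
  show "tight (face_points N) \<subseteq> N"
  proof
    fix K assume "K \<in> tight (face_points N)"
    then have K: "K \<in> B" "\<And>x. x \<in> face_points N \<Longrightarrow> mass K x = card (inside B K)"
      by (auto simp: tight_def)
    obtain C where C: "C \<in> N" "top_part N K \<subseteq> top_part N C" "K \<subseteq> C"
      using top_part_subset_block[OF nestsD(1)[OF N] finite_V nestsD(2)[OF N] in_building_setD(1)[OF K(1)]] .
    obtain i where i: "i \<in> top_part N K"
      using top_part_nonempty[OF nestsD(1)[OF N] finite_V in_building_setD(3,2)[OF K(1)]] by blast
    obtain r where r: "\<And>S. S \<in> B \<Longrightarrow> r S \<in> top_part N S" using top_part_choice[OF N] by blast
    let ?r = "r(C := i)"
    let ?c = "\<lambda>S j. if j = ?r S then 1 else (0::real)"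
    have r': "?r S \<in> top_part N S" if "S \<in> B" for S using r[OF that] i C(2) by auto
    have "\<forall>S\<in>B. \<forall>j\<in>S \<inter> K. \<not> S \<subseteq> K \<longrightarrow> ?c S j = 0"
      using mass_bound(2)[OF indicator_plan(1)[OF r'] finite_in_B[OF K(1)]]
        K(2)[OF indicator_plan(2)[OF r']] by blast
    moreover have "C \<in> B" "i \<in> C \<inter> K" "?c C i \<noteq> 0"
      using C nestsD(3)[OF N] i by (auto simp: top_part_def)
    ultimately have "C \<subseteq> K" by blast
    then show "K \<in> N" using C by (metis subset_antisym)
  qed
qed

text \<open>
  If \<open>K\<close> and \<open>L\<close> are incomparable with connected union, then \<open>K \<union> L\<close> is a member of \<open>B\<close> that is inside
  neither, so the lower bounds for \<open>K \<union> L\<close> and \<open>K \<inter> L\<close> add up to strictly more than those for \<open>K\<close> and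
  \<open>L\<close>. As mass is modular, \<open>K\<close> and \<open>L\<close> cannot both be tight.
\<close>

lemma tight_nests:
  assumes F: "F \<subseteq> P" "F \<noteq> {}"
  shows "tight F \<in> nests"
proof -
  have "V \<in> tight F"
  proof -
    have "mass V x = card (inside B V)" if "x \<in> F" for x
    proof -
      from subsetD[OF F(1) that] obtain c where c: "plan B c" "x = point B c" by (rule obtain_plan)
      show ?thesis using mass_bound(2)[OF c(1) finite_V] in_building_setD(1) c(2) by blast
    qed
    then show ?thesis using V_in_B by (simp add: tight_def)
  qed
  moreover have "nested E (tight F)"
    unfolding nested_def
  proof (intro ballI)
    fix K L assume "K \<in> tight F" "L \<in> tight F"
    then have KL: "K \<in> B" "L \<in> B" and tight: "\<And>x. x \<in> F \<Longrightarrow> mass K x = card (inside B K)"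
      "\<And>x. x \<in> F \<Longrightarrow> mass L x = card (inside B L)" by (auto simp: tight_def)
    show "K \<subseteq> L \<or> L \<subseteq> K \<or> \<not> induced_connected E (K \<union> L)"
    proof (rule ccontr)
      assume asm: "\<not> ?thesis"
      then have UB: "K \<union> L \<in> B" using KL by (auto simp: building_set_def)
      obtain x where x: "x \<in> F" using F(2) by blast
      from subsetD[OF F(1) x] obtain c where c: "plan B c" "x = point B c" by (rule obtain_plan)
      have fin: "finite K" "finite L" using KL finite_in_B by auto
      have "card (inside B (K \<union> L)) + card (inside B (K \<inter> L)) \<le> mass (K \<union> L) x + mass (K \<inter> L) x"
        using mass_bound(1)[OF c(1), of "K \<union> L"] mass_bound(1)[OF c(1), of "K \<inter> L"] fin
        unfolding c(2) by simp
      also have "\<dots> = card (inside B K) + card (inside B L)"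
        using mass_modular[OF fin, of x] tight x by simp
      also have "\<dots> = card (inside B K \<union> inside B L) + card (inside B K \<inter> inside B L)"
        using card_Un_Int[of "inside B K" "inside B L"] finite_B by simp
      also have "inside B K \<inter> inside B L = inside B (K \<inter> L)" by auto
      finally have "card (inside B (K \<union> L)) \<le> card (inside B K \<union> inside B L)" by simp
      moreover have "K \<union> L \<in> inside B (K \<union> L) - (inside B K \<union> inside B L)"
        using UB asm by blast
      then have "inside B K \<union> inside B L \<subset> inside B (K \<union> L)" by blast
      then have "card (inside B K \<union> inside B L) < card (inside B (K \<union> L))"
        using finite_B by (intro psubset_card_mono) auto
      ultimately show False by simp
    qed
  qed
  ultimately show ?thesis
    by (auto simp: nests_def nested_collections_def tight_def)
qed

text \<open>
  A motion inside \<open>P\<close> that only affects the simplex on \<open>S\<close>, which carries its mass at \<open>u\<close> over to \<open>v\<close>.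
\<close>

lemma point_shift:
  assumes z: "plan B z" and S: "S \<in> B" "u \<in> S" "v \<in> S" "u \<noteq> v"
  obtains c where "plan B c" "c S v = z S v + z S u"
    "point B c = point B z + z S u *\<^sub>R (basis_vector v - basis_vector u)"
proof -
  define c where "c = (\<lambda>S' i. z S' i +
    (if S' = S then z S u * ((if i = v then 1 else 0) - (if i = u then 1 else 0)) else 0))"
  have finS: "finite S" using finite_in_B S(1) .
  have "(\<Sum>i\<in>S'. c S' i) = 1" if "S' \<in> B" for S'
    using z that S finS unfolding c_def plan_def
    by (cases "S' = S") (simp_all add: sum.distrib sum_subtractf flip: sum_distrib_left)
  moreover have "0 \<le> c S' i" if "S' \<in> B" "i \<in> S'" for S' i
    using z that S unfolding c_def plan_def by auto
  ultimately have "plan B c" by (auto simp: plan_def)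
  moreover have "c S v = z S v + z S u" using S(4) by (simp add: c_def)
  moreover have "point B c = point B z + z S u *\<^sub>R (basis_vector v - basis_vector u)"
  proof -
    have "point B c = point B z + (\<Sum>S'\<in>B. if S' = S then \<Sum>i\<in>S. (z S u *
        ((if i = v then 1 else 0) - (if i = u then 1 else 0))) *\<^sub>R basis_vector i else 0)"
      unfolding point_def c_def sum.distrib[symmetric]
      by (intro sum.cong refl) (auto simp: scaleR_add_left sum.distrib)
    also have "\<dots> = point B z + (\<Sum>i\<in>S. (if i = v then z S u *\<^sub>R basis_vector v else 0)
        - (if i = u then z S u *\<^sub>R basis_vector u else 0))"
      using S(1) finite_B by (auto intro!: sum.cong)
    also have "\<dots> = point B z + z S u *\<^sub>R (basis_vector v - basis_vector u)"
      using finS S by (simp add: sum_subtractf scaleR_diff_right)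
    finally show ?thesis .
  qed
  ultimately show ?thesis by (rule that)
qed

text \<open>
  Averaging gives a point \<open>z\<close> of \<open>F\<close> whose plan is positive wherever some plan of a point of \<open>F\<close> is
  (on the sets \<open>T S\<close>). Any other point of \<open>P\<close> with a plan supported on \<open>T\<close> is the end of a segment in \<open>P\<close> with
  \<open>z\<close> in its interior, so it belongs to \<open>F\<close>. It remains to see that a vertex \<open>i\<close> of \<open>S\<close> outside \<open>T S\<close> is
  excluded by a tight set. Mass can flow from a vertex of \<open>T S'\<close> to any other vertex of \<open>S'\<close>; let \<open>K\<close> be
  the set of vertices reachable from \<open>i\<close>. It is connected and tight. If \<open>K\<close> contained \<open>S\<close>, it would
  contain some \<open>j \<in> T S\<close>, and one could move from \<open>z\<close> both by \<open>e\<^sub>j - e\<^sub>i\<close> and, within the simplex on \<open>S\<close>,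
  by \<open>e\<^sub>i - e\<^sub>j\<close>. Both ends would lie in \<open>F\<close>, the second one with positive entry at \<open>i\<close> in \<open>S\<close>.
\<close>

lemma face_points_tight:
  assumes F: "F face_of P" "F \<noteq> {}"
  shows "face_points (tight F) = F"
proof
  have FP: "F \<subseteq> P" and "convex F" using F(1) by (auto simp: face_of_def)
  have nests: "tight F \<in> nests" by (rule tight_nests[OF FP F(2)])
  show "F \<subseteq> face_points (tight F)"
    unfolding face_points_eq[OF nestsD(3)[OF nests]] using FP by (auto simp: tight_def)
  define T where "T S = {i \<in> S. \<exists>c. plan B c \<and> point B c \<in> F \<and> 0 < c S i}" for S
  have zero: "c S i = 0" if "plan B c" "point B c \<in> F" "S \<in> B" "i \<in> S" "i \<notin> T S" for c S i
  proof -
    have "0 \<le> c S i" using that(1,3,4) by (simp add: plan_def)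
    moreover have "\<not> 0 < c S i" using that unfolding T_def by blast
    ultimately show ?thesis by simp
  qed
  have average: "\<exists>z. plan B z \<and> point B z \<in> F \<and> (\<forall>q\<in>Q. 0 < z (fst q) (snd q))"
    if "finite Q" "Q \<subseteq> Sigma B T" for Q
    using that
  proof (induction Q rule: finite_induct)
    case empty
    obtain x where x: "x \<in> F" using F(2) by blast
    from subsetD[OF FP x] obtain c where "plan B c" "x = point B c" by (rule obtain_plan)
    then show ?case using x by blast
  next
    case (insert q Q)
    obtain S i where q: "q = (S, i)" "S \<in> B" "i \<in> T S" using insert.prems by auto
    obtain z where z: "plan B z" "point B z \<in> F" "\<forall>q\<in>Q. 0 < z (fst q) (snd q)"
      using insert.IH insert.prems by blast
    obtain c where c: "plan B c" "point B c \<in> F" "0 < c S i" using q(3) by (auto simp: T_def)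
    let ?y = "\<lambda>S i. 1/2 * z S i + 1/2 * c S i"
    have "plan B ?y" using plan_convex_combination[OF z(1) c(1), of "1/2" "1/2"] by simp
    moreover have "point B ?y \<in> F"
      using convexD[OF \<open>convex F\<close> z(2) c(2), of "1/2" "1/2"]
      unfolding point_affine_combination by simp
    moreover have "0 < ?y S' i'" if "(S', i') \<in> insert q Q" for S' i'
    proof -
      have "S' \<in> B" "i' \<in> S'" using that insert.prems by (auto simp: T_def)
      then have "0 \<le> z S' i'" "0 \<le> c S' i'" using z(1) c(1) by (auto simp: plan_def)
      moreover have "0 < z S' i' \<or> 0 < c S' i'" using that q(1) z(3) c(3) by force
      ultimately show ?thesis by (auto simp: add_nonneg_pos add_pos_nonneg)
    qed
    then have "\<forall>q\<in>insert q Q. 0 < ?y (fst q) (snd q)" by simp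
    ultimately show ?case by blast
  qed
  have fin_BT: "finite (Sigma B T)"
    using finite_B finite_in_B by (intro finite_SigmaI) (auto simp: T_def)
  obtain z where z: "plan B z" "point B z \<in> F" and "\<forall>q\<in>Sigma B T. 0 < z (fst q) (snd q)"
    using average[OF fin_BT order_refl] by blast
  then have pos: "0 < z S i" if "S \<in> B" "i \<in> T S" for S i
    using that by force
  have T_nonempty: "T S \<noteq> {}" if "S \<in> B" for S
  proof
    assume "T S = {}"
    then have "(\<Sum>i\<in>S. z S i) = 0" using zero[OF z that] by (intro sum.neutral) auto
    then show False using z(1) that by (simp add: plan_def)
  qed
  \<comment> \<open>The feasible directions at the point of \<open>z\<close>; convexity of \<open>P\<close> makes them closed under addition.\<close>
  define D where "D = {d. \<exists>\<delta>>0. point B z + \<delta> *\<^sub>R d \<in> P}"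
  have D_add: "d + d' \<in> D" if d: "d \<in> D" "d' \<in> D" for d d'
  proof -
    obtain \<delta> \<epsilon> where *: "\<delta> > 0" "point B z + \<delta> *\<^sub>R d \<in> P" "\<epsilon> > 0" "point B z + \<epsilon> *\<^sub>R d' \<in> P"
      using d unfolding D_def by blast
    have "(\<epsilon> / (\<delta> + \<epsilon>)) *\<^sub>R (point B z + \<delta> *\<^sub>R d) + (\<delta> / (\<delta> + \<epsilon>)) *\<^sub>R (point B z + \<epsilon> *\<^sub>R d') \<in> P"
    proof (rule convexD[OF convex_P *(2,4)])
      show "\<epsilon> / (\<delta> + \<epsilon>) + \<delta> / (\<delta> + \<epsilon>) = 1"
        using *(1,3) by (simp add: add_divide_distrib[symmetric] add.commute)
    qed (use *(1,3) in auto)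
    also have "(\<epsilon> / (\<delta> + \<epsilon>)) *\<^sub>R (point B z + \<delta> *\<^sub>R d) + (\<delta> / (\<delta> + \<epsilon>)) *\<^sub>R (point B z + \<epsilon> *\<^sub>R d')
        = (\<epsilon> / (\<delta> + \<epsilon>) + \<delta> / (\<delta> + \<epsilon>)) *\<^sub>R point B z + (\<delta> * \<epsilon> / (\<delta> + \<epsilon>)) *\<^sub>R (d + d')"
      by (simp add: algebra_simps)
    also have "\<epsilon> / (\<delta> + \<epsilon>) + \<delta> / (\<delta> + \<epsilon>) = 1"
      using *(1,3) by (simp add: add_divide_distrib[symmetric] add.commute)
    finally have "point B z + (\<delta> * \<epsilon> / (\<delta> + \<epsilon>)) *\<^sub>R (d + d') \<in> P" by simp
    then show ?thesis using * unfolding D_def by (intro CollectI exI[of _ "\<delta> * \<epsilon> / (\<delta> + \<epsilon>)"]) auto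
  qed
  \<comment> \<open>Mass at \<open>u\<close> can be moved to \<open>v\<close> within a single simplex.\<close>
  define R where "R = {(u, v). \<exists>S\<in>B. u \<in> T S \<and> v \<in> S}"
  have zP: "point B z \<in> P" using z FP by blast
  have D_0: "0 \<in> D" using zP by (auto simp: D_def intro!: exI[of _ 1])
  have D_step: "basis_vector v - basis_vector u \<in> D" if "(u, v) \<in> R" for u v
  proof (cases "u = v")
    case True
    then show ?thesis using D_0 by simp
  next
    case False
    obtain S where S: "S \<in> B" "u \<in> T S" "v \<in> S" using \<open>(u, v) \<in> R\<close> by (auto simp: R_def)
    then have "u \<in> S" by (auto simp: T_def)
    from point_shift[OF z(1) S(1) this S(3) False] obtain c where c: "plan B c"
      "point B c = point B z + z S u *\<^sub>R (basis_vector v - basis_vector u)" .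
    have "point B z + z S u *\<^sub>R (basis_vector v - basis_vector u) \<in> P"
      unfolding c(2)[symmetric] by (rule point_in_P[OF c(1)])
    then show ?thesis using pos[OF S(1,2)] by (auto simp: D_def)
  qed
  have D_reach: "basis_vector v - basis_vector u \<in> D" if "(u, v) \<in> R\<^sup>*" for u v
    using that
  proof (induction rule: rtrancl_induct)
    case base
    then show ?case using D_0 by simp
  next
    case (step v w)
    then show ?case using D_add[OF step.IH D_step[OF step.hyps(2)]] by simp
  qed
  have reach_tight: "{v. (i, v) \<in> R\<^sup>*} \<in> tight F" if "i \<in> V" for i
  proof -
    let ?K = "{v. (i, v) \<in> R\<^sup>*}"
    \<comment> \<open>The simplices that charge \<open>?K\<close> on \<open>F\<close> lie inside it, which is tightness.\<close>
    have closed: "S \<subseteq> ?K" if "S \<in> B" "u \<in> T S" "u \<in> ?K" for S u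
      using that by (auto simp: R_def intro: rtrancl_into_rtrancl)
    have KV: "?K \<subseteq> V"
    proof
      fix v assume "v \<in> ?K"
      then have "(i, v) \<in> R\<^sup>*" by simp
      then show "v \<in> V" by cases (use that in_building_setD(1) in \<open>auto simp: R_def\<close>)
    qed
    have "induced_connected E ?K"
    proof (rule induced_connectedI[of _ i])
      fix v assume "v \<in> ?K"
      then have "(i, v) \<in> R\<^sup>*" by simp
      then show "(i, v) \<in> {(x, y). x \<in> ?K \<and> y \<in> ?K \<and> {x, y} \<in> E}\<^sup>*"
      proof (induction rule: rtrancl_induct)
        case (step v w)
        then obtain S where S: "S \<in> B" "v \<in> T S" "w \<in> S" by (auto simp: R_def)
        have "(v, w) \<in> {(x, y). x \<in> S \<and> y \<in> S \<and> {x, y} \<in> E}\<^sup>*"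
          using in_building_setD(3)[OF S(1), unfolded induced_connected_def] S by (auto simp: T_def)
        moreover have "S \<subseteq> ?K" using closed[OF S(1,2)] step.hyps(1) by simp
        ultimately have "(v, w) \<in> {(x, y). x \<in> ?K \<and> y \<in> ?K \<and> {x, y} \<in> E}\<^sup>*"
          by (rule reachable_inside_mono)
        with step.IH show ?case by (rule rtrancl_trans)
      qed simp
    qed
    moreover have "i \<in> ?K" by simp
    ultimately have KB: "?K \<in> B" using KV unfolding building_set_def by blast
    moreover have "mass ?K x = card (inside B ?K)" if x: "x \<in> F" for x
    proof -
      from subsetD[OF FP x] obtain c where c: "plan B c" "x = point B c" by (rule obtain_plan)
      have "c S j = 0" if "S \<in> B" "j \<in> S \<inter> ?K" "\<not> S \<subseteq> ?K" for S j
      proof -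
        have "j \<notin> T S" using closed[OF that(1)] that(2,3) by blast
        then show ?thesis using zero[of c S j] c x that(1,2) by blast
      qed
      then show ?thesis using mass_bound(2)[OF c(1) finite_in_B[OF KB]] c(2) by blast
    qed
    ultimately show ?thesis by (simp add: tight_def)
  qed
  have top_T: "top_part (tight F) S \<subseteq> T S" if S: "S \<in> B" for S
  proof
    fix i assume i: "i \<in> top_part (tight F) S"
    then have iS: "i \<in> S" by (auto simp: top_part_def)
    then have "i \<in> V" using in_building_setD(1)[OF S] by blast
    then have "S \<subseteq> {v. (i, v) \<in> R\<^sup>*}"
      using i reach_tight[of i] by (auto simp: top_part_def)
    moreover obtain j where j: "j \<in> T S" using T_nonempty[OF S] by blast
    ultimately have "(i, j) \<in> R\<^sup>*" by (auto simp: T_def)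
    then obtain \<delta> where \<delta>: "\<delta> > 0" "point B z + \<delta> *\<^sub>R (basis_vector j - basis_vector i) \<in> P"
      using D_reach[of i j] by (auto simp: D_def)
    show "i \<in> T S"
    proof (rule ccontr)
      assume iT: "i \<notin> T S"
      have "j \<noteq> i" "j \<in> S" using j iT by (auto simp: T_def)
      from point_shift[OF z(1) S \<open>j \<in> S\<close> iS \<open>j \<noteq> i\<close>]
      obtain c where c: "plan B c" "c S i = z S i + z S j"
        "point B c = point B z + z S j *\<^sub>R (basis_vector i - basis_vector j)" .
      define d where "d = (basis_vector i - basis_vector j :: nat \<Rightarrow>\<^sub>0 real)"
      have \<epsilon>: "z S j > 0" using pos[OF S j] .
      have q: "point B c = point B z + z S j *\<^sub>R d" "point B c \<in> P"
        using c(3) point_in_P[OF c(1)] by (simp_all add: d_def)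
      have p: "point B z - \<delta> *\<^sub>R d \<in> P"
        using \<delta>(2) by (simp add: d_def scaleR_diff_right algebra_simps)
      have "d \<noteq> 0" using \<open>j \<noteq> i\<close> unfolding d_def
        by (metis eq_iff_diff_eq_0 lookup_single_eq lookup_single_not_eq zero_neq_one)
      have "point B z \<in> open_segment (point B z - \<delta> *\<^sub>R d) (point B z + z S j *\<^sub>R d)"
        unfolding in_segment
      proof (intro conjI exI[of _ "\<delta> / (\<delta> + z S j)"])
        have "(\<delta> + z S j) *\<^sub>R d \<noteq> 0" using \<open>d \<noteq> 0\<close> \<delta>(1) \<epsilon> by auto
        then show "point B z - \<delta> *\<^sub>R d \<noteq> point B z + z S j *\<^sub>R d"
          by (auto simp: algebra_simps)
        have e: "(1 - \<delta> / (\<delta> + z S j)) * \<delta> = (\<delta> / (\<delta> + z S j)) * z S j"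
          using \<delta>(1) \<epsilon> by (simp add: field_simps)
        have "(1 - \<delta> / (\<delta> + z S j)) *\<^sub>R (point B z - \<delta> *\<^sub>R d)
            + (\<delta> / (\<delta> + z S j)) *\<^sub>R (point B z + z S j *\<^sub>R d)
          = point B z + ((\<delta> / (\<delta> + z S j)) * z S j - (1 - \<delta> / (\<delta> + z S j)) * \<delta>) *\<^sub>R d"
          by (simp add: algebra_simps)
        then show "point B z = (1 - \<delta> / (\<delta> + z S j)) *\<^sub>R (point B z - \<delta> *\<^sub>R d)
            + (\<delta> / (\<delta> + z S j)) *\<^sub>R (point B z + z S j *\<^sub>R d)"
          by (simp add: e)
      qed (use \<delta>(1) \<epsilon> in auto)
      then have "point B c \<in> F"
        using face_ofD[OF F(1) _ p q(2) z(2)] q(1) by simp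
      then have "c S i = 0" using zero[OF c(1) _ S iS iT] by simp
      moreover have "z S i \<ge> 0" using z(1) S iS by (auto simp: plan_def)
      ultimately show False using \<epsilon> c(2) by simp
    qed
  qed
  show "face_points (tight F) \<subseteq> F"
  proof
    fix y assume "y \<in> face_points (tight F)"
    then obtain c where c: "plan B c" "y = point B c"
      and c0: "\<And>S i. S \<in> B \<Longrightarrow> i \<in> S \<Longrightarrow> i \<notin> T S \<Longrightarrow> c S i = 0"
      unfolding face_points_def using top_T by blast
    define \<epsilon> where "\<epsilon> = Min (insert 1 ((\<lambda>(S, i). z S i) ` Sigma B T))"
    have \<epsilon>: "\<epsilon> > 0" "\<And>S i. S \<in> B \<Longrightarrow> i \<in> T S \<Longrightarrow> \<epsilon> \<le> z S i"
      unfolding \<epsilon>_def using fin_BT pos by (auto intro!: Min_le)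
    \<comment> \<open>The segment from \<open>y\<close> through \<open>z\<close>, prolonged beyond \<open>z\<close> by \<open>\<epsilon>\<close> times its length.\<close>
    let ?q = "\<lambda>S i. (1 + \<epsilon>) * z S i + (- \<epsilon>) * c S i"
    have "plan B ?q"
      unfolding plan_def
    proof (intro ballI conjI)
      fix S assume S: "S \<in> B"
      show "(\<Sum>i\<in>S. ?q S i) = 1"
        using plan_affine_combination_sum[OF z(1) c(1) _ S, of "1 + \<epsilon>" "- \<epsilon>"] by simp
      fix i assume i: "i \<in> S"
      show "0 \<le> ?q S i"
      proof (cases "i \<in> T S")
        case True
        have "c S i \<le> (\<Sum>i\<in>S. c S i)"
          using c(1) S i finite_in_B[OF S] by (intro member_le_sum) (auto simp: plan_def)
        then have "c S i \<le> 1" using c(1) S by (simp add: plan_def)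
        then have "\<epsilon> * c S i \<le> \<epsilon> * 1" using \<epsilon>(1) by (intro mult_left_mono) auto
        also have "\<dots> \<le> z S i" using \<epsilon>(2)[OF S True] by simp
        also have "\<dots> \<le> (1 + \<epsilon>) * z S i"
          using \<epsilon>(1) pos[OF S True] by (simp add: algebra_simps)
        finally show ?thesis by simp
      next
        case False
        then show ?thesis using zero[OF z S i] c0[OF S i] by simp
      qed
    qed
    then have qP: "point B ?q \<in> P" by (rule point_in_P)
    have yP: "y \<in> P" unfolding c(2) by (rule point_in_P[OF c(1)])
    have q: "point B ?q = (1 + \<epsilon>) *\<^sub>R point B z + (- \<epsilon>) *\<^sub>R y"
      unfolding c(2) point_affine_combination ..
    show "y \<in> F"
    proof (cases "y = point B z")
      case False
      have "point B z \<in> open_segment y (point B ?q)"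
        unfolding in_segment
      proof (intro conjI exI[of _ "1 / (1 + \<epsilon>)"])
        have "(1 + \<epsilon>) *\<^sub>R (point B z - y) \<noteq> 0" using False \<epsilon>(1) by auto
        then show "y \<noteq> point B ?q" unfolding q by (auto simp: algebra_simps)
        have "(1 / (1 + \<epsilon>)) *\<^sub>R point B ?q = point B z + (- \<epsilon> / (1 + \<epsilon>)) *\<^sub>R y"
        proof -
          have "(1 / (1 + \<epsilon>)) *\<^sub>R point B ?q
              = (1 / (1 + \<epsilon>) * (1 + \<epsilon>)) *\<^sub>R point B z + (1 / (1 + \<epsilon>) * - \<epsilon>) *\<^sub>R y"
            unfolding q by (simp only: scaleR_add_right scaleR_scaleR)
          moreover have "1 / (1 + \<epsilon>) * (1 + \<epsilon>) = 1" using \<epsilon>(1) by simp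
          ultimately show ?thesis by simp
        qed
        moreover have "1 - 1 / (1 + \<epsilon>) = \<epsilon> / (1 + \<epsilon>)" using \<epsilon>(1) by (simp add: field_simps)
        ultimately show "point B z = (1 - 1 / (1 + \<epsilon>)) *\<^sub>R y + (1 / (1 + \<epsilon>)) *\<^sub>R point B ?q"
          by simp
      qed (use \<epsilon>(1) in auto)
      then show ?thesis using face_ofD[OF F(1) _ yP qP z(2)] by blast
    qed (use z in simp)
  qed
qed

lemma bij_betw_faces: "bij_betw face_points nests {F. F face_of P \<and> F \<noteq> {}}"
proof (rule bij_betw_byWitness[of _ tight])
  show "face_points ` nests \<subseteq> {F. F face_of P \<and> F \<noteq> {}}"
    using face_points_face_of nestsD(3) face_points_nonempty by blast
  show "tight ` {F. F face_of P \<and> F \<noteq> {}} \<subseteq> nests"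
    using tight_nests face_of_imp_subset by blast
qed (use tight_face_points face_points_tight in auto)

end

section \<open>Dimensions of the faces\<close>

context connected_graph
begin

lemma point_indicator:
  assumes "\<And>S. S \<in> B \<Longrightarrow> r S \<in> S"
  shows "point B (\<lambda>S i. if i = r S then 1 else 0) = (\<Sum>S\<in>B. basis_vector (r S))"
  unfolding point_def
proof (rule sum.cong[OF refl])
  fix S assume S: "S \<in> B"
  have "(\<Sum>i\<in>S. (if i = r S then 1 else 0) *\<^sub>R basis_vector i)
      = (\<Sum>i\<in>S. if i = r S then basis_vector (r S) else 0)"
    by (rule sum.cong) auto
  also have "\<dots> = basis_vector (r S)" using assms[OF S] finite_in_B[OF S] by simp
  finally show "(\<Sum>i\<in>S. (if i = r S then 1 else 0) *\<^sub>R basis_vector i) = basis_vector (r S)" .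
qed

text \<open>
  The top parts of the members of \<open>N\<close> partition \<open>V\<close>, and the direction space of the face is spanned by
  the differences of basis vectors within the blocks. Subtracting a representative of its block from
  every other vertex gives a basis of \<open>card V - card N\<close> vectors.
\<close>

lemma affine_dimension_face_points:
  assumes N: "N \<in> nests"
  shows "affine_dimension (face_points N) = card V - card N"
proof -
  obtain r where r: "\<And>S. S \<in> B \<Longrightarrow> r S \<in> top_part N S" using top_part_choice[OF N] by blast
  have rN: "r C \<in> top_part N C" if "C \<in> N" for C using r nestsD(3)[OF N] that by blast
  have rS: "r S \<in> S" if "S \<in> B" for S using r[OF that] by (simp add: top_part_def)
  have "\<forall>i\<in>V. \<exists>C. C \<in> N \<and> i \<in> top_part N C"
  proof
    fix i assume "i \<in> V"
    then have "{i} \<subseteq> V" by simp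
    from top_part_subset_block[OF nestsD(1)[OF N] finite_V nestsD(2)[OF N] this]
    obtain C where "C \<in> N" "top_part N {i} \<subseteq> top_part N C" by blast
    moreover have "i \<in> top_part N {i}" by (simp add: top_part_def)
    ultimately show "\<exists>C. C \<in> N \<and> i \<in> top_part N C" by blast
  qed
  from bchoice[OF this] obtain blk where
    blk: "\<And>i. i \<in> V \<Longrightarrow> blk i \<in> N" "\<And>i. i \<in> V \<Longrightarrow> i \<in> top_part N (blk i)" by blast
  define R where "R = r ` N"
  define g where "g i = (basis_vector i - basis_vector (r (blk i)) :: nat \<Rightarrow>\<^sub>0 real)" for i
  let ?F = "face_points N"
  let ?D = "{x - y |x y. x \<in> ?F \<and> y \<in> ?F}"
  have RV: "R \<subseteq> V"
  proof -
    have "r C \<in> V" if "C \<in> N" for C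
    proof -
      have "C \<in> B" using that nestsD(3)[OF N] by blast
      then show ?thesis using rS in_building_setD(1) by blast
    qed
    then show ?thesis by (auto simp: R_def)
  qed
  have "inj_on r N"
    by (rule inj_onI) (metis rN top_part_disjoint)
  then have card_R: "card (V - R) = card V - card N"
    using RV finite_V by (simp add: card_Diff_subset finite_subset R_def card_image)
  have lookup_g: "Poly_Mapping.lookup (g i) j = (if i = j then 1 else 0)"
    if "i \<in> V - R" "j \<in> V - R" for i j
  proof -
    have "r (blk i) \<noteq> j" using that blk(1)[of i] by (auto simp: R_def)
    then show ?thesis by (simp add: g_def lookup_minus lookup_single when_def)
  qed
  have inj: "inj_on g (V - R)"
  proof (rule inj_onI)
    fix i j assume ij: "i \<in> V - R" "j \<in> V - R" "g i = g j"
    then show "i = j"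
      using lookup_g[OF ij(1,2)] lookup_g[OF ij(2,2)] by (simp split: if_splits)
  qed
  have ind: "independent (g ` (V - R))"
  proof (rule independent_if_scalars_zero)
    show "finite (g ` (V - R))" using finite_V by simp
    fix f x assume zero: "(\<Sum>x\<in>g ` (V - R). f x *\<^sub>R x) = 0" and "x \<in> g ` (V - R)"
    then obtain j where j: "j \<in> V - R" "x = g j" by blast
    have "0 = Poly_Mapping.lookup (\<Sum>i\<in>V - R. f (g i) *\<^sub>R g i) j"
      using zero by (simp add: sum.reindex[OF inj])
    also have "\<dots> = (\<Sum>i\<in>V - R. f (g i) * Poly_Mapping.lookup (g i) j)"
      by (simp add: lookup_sum lookup_scaleR)
    also have "\<dots> = (\<Sum>i\<in>V - R. if i = j then f (g i) else 0)"
      by (rule sum.cong[OF refl]) (simp add: lookup_g[OF _ j(1)])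
    also have "\<dots> = f x" using finite_V j by simp
    finally show "f x = 0" ..
  qed
  have sub: "g ` (V - R) \<subseteq> ?D"
  proof (rule image_subsetI)
    fix i assume i: "i \<in> V - R"
    \<comment> \<open>Two points of the face that differ only in the simplex on \<open>blk i\<close>.\<close>
    define s where "s = r(blk i := i)"
    have "blk i \<in> B" using blk(1)[of i] nestsD(3)[OF N] i by blast
    have s': "s S \<in> top_part N S" if "S \<in> B" for S
      using r[OF that] blk(2)[of i] i by (simp add: s_def)
    have sS: "s S \<in> S" if "S \<in> B" for S using s'[OF that] by (simp add: top_part_def)
    have "point B (\<lambda>S i. if i = s S then 1 else 0) - point B (\<lambda>S i. if i = r S then 1 else 0)
        = (\<Sum>S\<in>B. basis_vector (s S) - basis_vector (r S))"
    proof -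
      have "point B (\<lambda>S i. if i = r S then 1 else 0) = (\<Sum>S\<in>B. basis_vector (r S))"
        by (rule point_indicator) (rule rS)
      moreover have "point B (\<lambda>S i. if i = s S then 1 else 0) = (\<Sum>S\<in>B. basis_vector (s S))"
        by (rule point_indicator) (rule sS)
      ultimately show ?thesis by (simp only: sum_subtractf)
    qed
    also have "\<dots> = (\<Sum>S\<in>B. if S = blk i then g i else 0)"
      by (rule sum.cong) (auto simp: g_def s_def)
    also have "\<dots> = g i" using \<open>blk i \<in> B\<close> finite_B by simp
    finally show "g i \<in> ?D"
      using indicator_plan(2)[OF r] indicator_plan(2)[OF s'] by (intro CollectI exI conjI) (rule sym)
  qed
  have spn: "?D \<subseteq> span (g ` (V - R))"
  proof
    fix d assume "d \<in> ?D"
    then obtain x y where xy: "d = x - y" "x \<in> ?F" "y \<in> ?F" by blast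
    from xy(2) obtain c where c: "plan B c" "x = point B c"
      "\<forall>S\<in>B. \<forall>i\<in>S. i \<notin> top_part N S \<longrightarrow> c S i = 0" unfolding face_points_def by blast
    from xy(3) obtain c' where c': "plan B c'" "y = point B c'"
      "\<forall>S\<in>B. \<forall>i\<in>S. i \<notin> top_part N S \<longrightarrow> c' S i = 0" unfolding face_points_def by blast
    have "d = (\<Sum>S\<in>B. \<Sum>i\<in>S. (c S i - c' S i) *\<^sub>R basis_vector i)"
      unfolding xy(1) c(2) c'(2) point_def by (simp add: sum_subtractf scaleR_diff_left)
    also have "\<dots> \<in> span (g ` (V - R))"
    proof (rule span_sum)
      fix S assume S: "S \<in> B"
      obtain C where C: "C \<in> N" "top_part N S \<subseteq> top_part N C"
        using top_part_subset_block[OF nestsD(1)[OF N] finite_V nestsD(2)[OF N] in_building_setD(1)[OF S]] by blast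
      \<comment> \<open>Both rows sum to 1, so the representative of the block can be subtracted for free.\<close>
      have "(\<Sum>i\<in>S. (c S i - c' S i)) = 0" using c(1) c'(1) S by (simp add: plan_def sum_subtractf)
      then have "(\<Sum>i\<in>S. (c S i - c' S i) *\<^sub>R basis_vector (r C)) = 0"
        by (simp flip: scaleR_left.sum)
      then have "(\<Sum>i\<in>S. (c S i - c' S i) *\<^sub>R basis_vector i)
          = (\<Sum>i\<in>S. (c S i - c' S i) *\<^sub>R (basis_vector i - basis_vector (r C)))"
        by (simp add: scaleR_diff_right sum_subtractf)
      also have "\<dots> \<in> span (g ` (V - R))"
      proof (rule span_sum)
        fix i assume i: "i \<in> S"
        show "(c S i - c' S i) *\<^sub>R (basis_vector i - basis_vector (r C)) \<in> span (g ` (V - R))"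
        proof (cases "i \<in> top_part N S")
          case False
          then show ?thesis using c(3) c'(3) S i by (simp add: span_zero)
        next
          case True
          then have iC: "i \<in> top_part N C" using C(2) by blast
          have "i \<in> V" using i in_building_setD(1)[OF S] by blast
          have "basis_vector i - basis_vector (r C) \<in> span (g ` (V - R))"
          proof (cases "i \<in> R")
            case True
            then obtain C' where "C' \<in> N" "i = r C'" by (auto simp: R_def)
            then have "i = r C" using top_part_disjoint[OF _ C(1) _ iC] rN by blast
            then show ?thesis by (simp add: span_zero)
          next
            case False
            have "blk i = C"
              using top_part_disjoint[OF blk(1) C(1) blk(2) iC] \<open>i \<in> V\<close> by blast
            then have "basis_vector i - basis_vector (r C) = g i" by (simp add: g_def)
            then show ?thesis using False \<open>i \<in> V\<close> by (auto intro: span_base)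
          qed
          then show ?thesis by (rule span_scale)
        qed
      qed
      finally show "(\<Sum>i\<in>S. (c S i - c' S i) *\<^sub>R basis_vector i) \<in> span (g ` (V - R))" .
    qed
    finally show "d \<in> span (g ` (V - R))" .
  qed
  have "card (g ` (V - R)) = card V - card N"
    using card_image[OF inj] card_R by simp
  then show ?thesis
    unfolding affine_dimension_def by (rule dim_unique[OF sub spn ind])
qed

lemma affine_dimension_P: "affine_dimension P = card V - 1"
proof -
  have "{V} \<in> nests"
    using V_in_B by (auto simp: nests_def nested_collections_def nested_def)
  moreover have "face_points {V} = P"
  proof -
    have "top_part {V} S = S" if "S \<in> B" for S using in_building_setD(1)[OF that] by (auto simp: top_part_def)
    then show ?thesis unfolding face_points_def P_eq by (intro arg_cong[of _ _ "image _"]) auto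
  qed
  ultimately show ?thesis using affine_dimension_face_points by fastforce
qed

lemma card_nests:
  assumes "N \<in> nests"
  shows "1 \<le> card N" "card N \<le> card V"
proof -
  have "card N > 0" using nestsD(2,4)[OF assms] by (auto simp: card_gt_0_iff)
  then show "1 \<le> card N" by simp
  have "\<Union>N = V" using nestsD(2)[OF assms] nested_collectionsD(6)[OF nestsD(1)[OF assms]] by blast
  then show "card N \<le> card V" using card_nested_le[OF nestsD(1)[OF assms] finite_V] by simp
qed

lemma face_number_P: "face_number P i = card {N \<in> nests. card V - card N = i}"
proof -
  have "{F. F face_of P \<and> F \<noteq> {} \<and> affine_dimension F = i}
      = {F \<in> face_points ` nests. affine_dimension F = i}"
    unfolding bij_betw_imp_surj_on[OF bij_betw_faces] by blast
  also have "\<dots> = face_points ` {N \<in> nests. card V - card N = i}"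
    using affine_dimension_face_points by auto
  finally have "{F. F face_of P \<and> F \<noteq> {} \<and> affine_dimension F = i}
      = face_points ` {N \<in> nests. card V - card N = i}" .
  moreover have "inj_on face_points {N \<in> nests. card V - card N = i}"
    by (rule inj_on_subset[OF bij_betw_imp_inj_on[OF bij_betw_faces]]) auto
  ultimately show ?thesis by (simp add: face_number_def card_image)
qed

lemma finite_nests: "finite nests"
  unfolding nests_def using finite_nested_collections[OF finite_V] by simp

lemma F_poly_nests:
  fixes a t :: "'r :: comm_ring_1"
  shows "F_poly P a t = (\<Sum>N\<in>nests. a ^ (card V - card N) * t ^ (card N - 1))"
proof -
  let ?d = "card V - 1"
  have "F_poly P a t
      = (\<Sum>i\<le>?d. \<Sum>N\<in>{N \<in> nests. card V - card N = i}. a ^ i * t ^ (?d - i))"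
    by (simp add: F_poly_def affine_dimension_P face_number_P mult.assoc)
  also have "\<dots> = (\<Sum>i\<le>?d. \<Sum>N\<in>{N \<in> nests. card V - card N = i}. a ^ (card V - card N) * t ^ (card N - 1))"
  proof (intro sum.cong refl)
    fix i N assume "N \<in> {N \<in> nests. card V - card N = i}"
    then have "i = card V - card N" "?d - i = card N - 1"
      using card_nests[of N] by auto
    then show "a ^ i * t ^ (?d - i) = a ^ (card V - card N) * t ^ (card N - 1)" by simp
  qed
  also have "\<dots> = (\<Sum>N\<in>nests. a ^ (card V - card N) * t ^ (card N - 1))"
    using finite_nests card_nests by (intro sum.group) (auto intro!: diff_le_mono2)
  finally show ?thesis .
qed

end

section \<open>Weighted counts of nested collections\<close>

text \<open>
  All three weights have one factor \<open>t\<close> per member of the collection and a complementary power of \<open>a\<close>.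
  The power of \<open>a\<close> in \<open>weight_open\<close> is lower by one because its collections are the nested collections
  of the faces with the member \<open>V\<close> removed.
\<close>

definition weight_all :: "nat set set \<Rightarrow> 'r \<Rightarrow> 'r \<Rightarrow> nat set \<Rightarrow> 'r :: comm_ring_1" where
  "weight_all E a t V =
     (\<Sum>N\<in>nested_collections E V. a ^ (card V - card N) * t ^ card N)"

definition weight_cover :: "nat set set \<Rightarrow> 'r \<Rightarrow> 'r \<Rightarrow> nat set \<Rightarrow> 'r :: comm_ring_1" where
  "weight_cover E a t V =
     (\<Sum>N\<in>{N \<in> nested_collections E V. V \<subseteq> \<Union>N}. a ^ (card V - card N) * t ^ card N)"

definition weight_open :: "nat set set \<Rightarrow> 'r \<Rightarrow> 'r \<Rightarrow> nat set \<Rightarrow> 'r :: comm_ring_1" where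
  "weight_open E a t V =
     (\<Sum>N\<in>{N \<in> nested_collections E V. \<not> V \<subseteq> \<Union>N}. a ^ (card V - 1 - card N) * t ^ card N)"

lemma nested_collections_empty: "nested_collections E {} = {{}}"
  by (auto simp: nested_collections_def building_set_def nested_def)

lemma weight_empty [simp]:
  "weight_all E a t {} = 1" "weight_cover E a t {} = 1" "weight_open E a t {} = 0"
  by (simp_all add: weight_all_def weight_cover_def weight_open_def nested_collections_empty)

context connected_graph
begin

lemma nests_eq: "nests = {N \<in> nested_collections E V. V \<subseteq> \<Union>N}"
proof -
  have "V \<in> N" if N: "N \<in> nested_collections E V" "V \<subseteq> \<Union>N" for N
  proof -
    obtain K where K: "K \<in> N" "V \<subseteq> K"
      by (rule connected_covered_subset[OF N(1) finite_V connected_V V_nonempty N(2)])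
    then have "K = V" using nested_collectionsD(4)[OF N(1) K(1)] by blast
    then show ?thesis using K by simp
  qed
  then show ?thesis unfolding nests_def by auto
qed

text \<open>
  Removing \<open>V\<close> from a nested collection uncovers a vertex, since no smaller members can cover the
  connected set \<open>V\<close>; conversely \<open>V\<close> is comparable with every member and can always be added.
\<close>

lemma sum_nests:
  "(\<Sum>N\<in>nests. f (card N)) =
     (\<Sum>N\<in>{N \<in> nested_collections E V. \<not> V \<subseteq> \<Union>N}. f (Suc (card N)))"
proof (rule sum.reindex_bij_witness[where i = "insert V" and j = "\<lambda>N. N - {V}"])
  fix N assume N: "N \<in> nests"
  show "insert V (N - {V}) = N" using nestsD(2)[OF N] by blast
  have N': "N - {V} \<in> nested_collections E V"
    using N by (auto simp: nests_def nested_collections_def nested_def)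
  moreover have "N - {V} \<notin> nests" by (simp add: nests_def)
  ultimately show "N - {V} \<in> {N \<in> nested_collections E V. \<not> V \<subseteq> \<Union>N}"
    unfolding nests_eq by blast
  show "f (Suc (card (N - {V}))) = f (card N)"
    using nestsD(2,4)[OF N] by (simp only: card_Suc_Diff1)
next
  fix N assume N: "N \<in> {N \<in> nested_collections E V. \<not> V \<subseteq> \<Union>N}"
  then show "insert V N - {V} = N" by blast
  have "nested E (insert V N)"
    unfolding nested_def using N nested_collectionsD(1,4)[of N E V]
    by (auto simp: nested_def)
  then show "insert V N \<in> nests"
    using N V_in_B by (auto simp: nests_def nested_collections_def)
qed

lemma F_poly_eq_weight_open: "F_poly P a t = weight_open E a t V"
  unfolding F_poly_nests weight_open_def
  by (subst sum_nests) simp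

lemma weight_cover_connected: "weight_cover E a t V = t * weight_open E a t V"
proof -
  have "weight_cover E a t V = (\<Sum>N\<in>nests. a ^ (card V - card N) * t ^ card N)"
    unfolding weight_cover_def nests_eq ..
  also have "\<dots> = t * weight_open E a t V"
    unfolding weight_open_def sum_distrib_left
    by (subst sum_nests) (simp add: algebra_simps)
  finally show ?thesis .
qed

text \<open>
  Splitting by whether \<open>V\<close> is a member: each collection without \<open>V\<close> either stays as it is or
  receives \<open>V\<close>.
\<close>

lemma weight_all_connected: "weight_all E a t V = (a + t) * weight_open E a t V"
proof -
  have fin: "finite (nested_collections E V)" by (rule finite_nested_collections[OF finite_V])
  have "nested_collections E V = {N \<in> nested_collections E V. V \<subseteq> \<Union>N}
      \<union> {N \<in> nested_collections E V. \<not> V \<subseteq> \<Union>N}" by blast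
  then have "weight_all E a t V = weight_cover E a t V
      + (\<Sum>N\<in>{N \<in> nested_collections E V. \<not> V \<subseteq> \<Union>N}. a ^ (card V - card N) * t ^ card N)"
    unfolding weight_all_def weight_cover_def using fin
    by (subst sum.union_disjoint[symmetric]) auto
  also have "(\<Sum>N\<in>{N \<in> nested_collections E V. \<not> V \<subseteq> \<Union>N}. a ^ (card V - card N) * t ^ card N)
      = a * weight_open E a t V"
    unfolding weight_open_def sum_distrib_left
  proof (rule sum.cong[OF refl])
    fix N assume N: "N \<in> {N \<in> nested_collections E V. \<not> V \<subseteq> \<Union>N}"
    then have "\<Union>N \<subset> V" using nested_collectionsD(6)[of N E V] by blast
    then have "card (\<Union>N) < card V" by (rule psubset_card_mono[OF finite_V])
    moreover have "card N \<le> card (\<Union>N)" using N card_nested_le[OF _ finite_V] by blast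
    ultimately have "card V - card N = Suc (card V - 1 - card N)" by simp
    then show "a ^ (card V - card N) * t ^ card N = a * (a ^ (card V - 1 - card N) * t ^ card N)"
      by (simp add: mult.assoc)
  qed
  finally show ?thesis by (simp add: weight_cover_connected distrib_right add.commute)
qed

end

lemma nested_collections_restrict:
  assumes "X \<subseteq> V"
  shows "nested_collections E X = {N \<in> nested_collections E V. \<Union>N \<subseteq> X}"
  using assms by (auto simp: nested_collections_def building_set_def)

text \<open>
  A connected set cannot meet both parts, so a nested collection is a pair of nested collections of
  the parts, and the cover condition concerns only the first.
\<close>

lemma weight_disjoint_union:
  assumes fin: "finite V1" "finite V2" and disj: "V1 \<inter> V2 = {}"
    and sep: "\<And>u v. u \<in> V1 \<Longrightarrow> v \<in> V2 \<Longrightarrow> {u, v} \<notin> E"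
  shows "(\<Sum>N\<in>{N \<in> nested_collections E (V1 \<union> V2). V1 \<subseteq> \<Union>N}.
            a ^ (card (V1 \<union> V2) - card N) * t ^ card N)
       = weight_cover E a t V1 * weight_all E a t V2"
proof -
  let ?X = "{N \<in> nested_collections E V1. V1 \<subseteq> \<Union>N}"
  let ?Y = "nested_collections E V2"
  let ?f = "\<lambda>n k. a ^ (n - k) * t ^ k"
  have not_conn: "\<not> induced_connected E (K \<union> L)"
    if KL: "K \<noteq> {}" "K \<subseteq> V1" "L \<noteq> {}" "L \<subseteq> V2" for K L
  proof
    assume conn: "induced_connected E (K \<union> L)"
    obtain u v where "u \<in> K" "v \<in> L" using KL by blast
    then have "u \<in> (K \<union> L) \<inter> V1" "v \<in> (K \<union> L) - V1" using KL disj by auto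
    from crossing_edge[OF conn this] obtain x y
      where "x \<in> (K \<union> L) \<inter> V1" "y \<in> (K \<union> L) - V1" "{x, y} \<in> E" .
    then show False using sep[of x y] KL by auto
  qed
  have split: "K \<subseteq> V1 \<or> K \<subseteq> V2" if K: "K \<in> building_set (V1 \<union> V2) E" for K
  proof (rule ccontr)
    assume "\<not> (K \<subseteq> V1 \<or> K \<subseteq> V2)"
    then have "K \<inter> V1 \<noteq> {}" "K \<inter> V2 \<noteq> {}" using K by (auto simp: building_set_def)
    moreover have "K = K \<inter> V1 \<union> K \<inter> V2" using K by (auto simp: building_set_def)
    ultimately show False
      using not_conn[of "K \<inter> V1" "K \<inter> V2"] K by (auto simp: building_set_def)
  qed
  have "weight_cover E a t V1 * weight_all E a t V2
      = (\<Sum>p\<in>?X \<times> ?Y. ?f (card V1) (card (fst p)) * ?f (card V2) (card (snd p)))"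
    unfolding weight_cover_def weight_all_def sum_product sum.cartesian_product
    by (simp add: case_prod_unfold)
  also have "\<dots> = (\<Sum>N\<in>{N \<in> nested_collections E (V1 \<union> V2). V1 \<subseteq> \<Union>N}.
      ?f (card (V1 \<union> V2)) (card N))"
  proof (rule sum.reindex_bij_witness[where j = "\<lambda>p. fst p \<union> snd p"
        and i = "\<lambda>N. ({K \<in> N. K \<subseteq> V1}, {K \<in> N. K \<subseteq> V2})"])
    fix p assume "p \<in> ?X \<times> ?Y"
    then obtain N1 N2 where p: "p = (N1, N2)" and N1: "N1 \<in> nested_collections E V1" "V1 \<subseteq> \<Union>N1"
      and N2: "N2 \<in> nested_collections E V2" by auto
    note D1 = nested_collectionsD[OF N1(1)] and D2 = nested_collectionsD[OF N2]
    have no: "\<not> K \<subseteq> V2" if "K \<in> N1" for K using D1(3,4)[OF that] disj by blast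
    have no': "\<not> K \<subseteq> V1" if "K \<in> N2" for K using D2(3,4)[OF that] disj by blast
    show "({K \<in> fst p \<union> snd p. K \<subseteq> V1}, {K \<in> fst p \<union> snd p. K \<subseteq> V2}) = p"
    proof -
      have "{K \<in> N1 \<union> N2. K \<subseteq> V1} = N1" using no' D1(4) by blast
      moreover have "{K \<in> N1 \<union> N2. K \<subseteq> V2} = N2" using no D2(4) by blast
      ultimately show ?thesis by (simp add: p)
    qed
    have "nested E (N1 \<union> N2)"
      unfolding nested_def
    proof (intro ballI)
      fix K L assume KL: "K \<in> N1 \<union> N2" "L \<in> N1 \<union> N2"
      have mix: "\<not> induced_connected E (K \<union> L)" if "K \<in> N1" "L \<in> N2" for K L
        using not_conn D1(3,4)[OF that(1)] D2(3,4)[OF that(2)] by blast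
      show "K \<subseteq> L \<or> L \<subseteq> K \<or> \<not> induced_connected E (K \<union> L)"
      proof -
        consider "K \<in> N1" "L \<in> N1" | "K \<in> N2" "L \<in> N2" | "K \<in> N1" "L \<in> N2"
          | "L \<in> N1" "K \<in> N2" using KL by blast
        then show ?thesis
        proof cases
          case 1
          then show ?thesis using D1(1) unfolding nested_def by blast
        next
          case 2
          then show ?thesis using D2(1) unfolding nested_def by blast
        next
          case 3
          then show ?thesis using mix by blast
        next
          case 4
          then have "\<not> induced_connected E (L \<union> K)" by (rule mix)
          then show ?thesis by (simp add: Un_commute)
        qed
      qed
    qed
    moreover have "N1 \<union> N2 \<subseteq> building_set (V1 \<union> V2) E"
      using D1(5) D2(5) by (auto simp: building_set_def)
    ultimately show "fst p \<union> snd p \<in> {N \<in> nested_collections E (V1 \<union> V2). V1 \<subseteq> \<Union>N}"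
      using N1(2) by (auto simp: p nested_collections_def)
    have "N1 \<inter> N2 = {}" using no D2(4) by blast
    then have c: "card (N1 \<union> N2) = card N1 + card N2"
      using D1(7)[OF fin(1)] D2(7)[OF fin(2)] by (rule card_Un_disjoint[rotated 2])
    have "card N1 \<le> card V1" "card N2 \<le> card V2"
      using card_nested_le[OF N1(1) fin(1)] card_nested_le[OF N2 fin(2)]
        card_mono[OF fin(1) D1(6)] card_mono[OF fin(2) D2(6)] by linarith+
    then have e: "card V1 + card V2 - (card N1 + card N2) = (card V1 - card N1) + (card V2 - card N2)"
      by simp
    show "?f (card (V1 \<union> V2)) (card (fst p \<union> snd p))
        = ?f (card V1) (card (fst p)) * ?f (card V2) (card (snd p))"
      by (simp add: p c card_Un_disjoint[OF fin disj] e power_add mult_ac)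
  next
    fix N assume "N \<in> {N \<in> nested_collections E (V1 \<union> V2). V1 \<subseteq> \<Union>N}"
    then have N: "N \<in> nested_collections E (V1 \<union> V2)" and cov: "V1 \<subseteq> \<Union>N" by auto
    note D = nested_collectionsD[OF N]
    have sp: "K \<subseteq> V1 \<or> K \<subseteq> V2" if "K \<in> N" for K using split D(5) that by blast
    show "fst ({K \<in> N. K \<subseteq> V1}, {K \<in> N. K \<subseteq> V2}) \<union> snd ({K \<in> N. K \<subseteq> V1}, {K \<in> N. K \<subseteq> V2}) = N"
      using sp by auto
    have "V1 \<subseteq> \<Union>{K \<in> N. K \<subseteq> V1}"
    proof
      fix x assume x: "x \<in> V1"
      then obtain K where K: "K \<in> N" "x \<in> K" using cov by blast
      then have "K \<subseteq> V1" using sp[OF K(1)] x disj by blast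
      then show "x \<in> \<Union>{K \<in> N. K \<subseteq> V1}" using K by blast
    qed
    then show "({K \<in> N. K \<subseteq> V1}, {K \<in> N. K \<subseteq> V2}) \<in> ?X \<times> ?Y"
      using D(1,5) by (auto simp: nested_collections_def nested_def building_set_def)
  qed
  finally show ?thesis ..
qed

section \<open>Nested collections of paths and cycles\<close>

text \<open>
  The vertices of an induced path, listed in order. A list makes segments easy to cut out and also
  describes an arc of the cycle that runs through the closing edge.
\<close>

definition path_like :: "nat set set \<Rightarrow> nat list \<Rightarrow> bool" where
  "path_like E xs \<longleftrightarrow> distinct xs \<and>
     (\<forall>k<length xs. \<forall>l<length xs. {xs ! k, xs ! l} \<in> E \<longleftrightarrow> l = Suc k \<or> k = Suc l)"

lemma path_like_take: "path_like E xs \<Longrightarrow> path_like E (take i xs)"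
  by (simp add: path_like_def)

lemma path_like_drop:
  assumes "path_like E xs"
  shows "path_like E (drop i xs)"
  unfolding path_like_def
proof (intro conjI allI impI)
  show "distinct (drop i xs)" using assms by (simp add: path_like_def)
  fix k l assume "k < length (drop i xs)" "l < length (drop i xs)"
  then have "i + k < length xs" "i + l < length xs" by auto
  then show "({drop i xs ! k, drop i xs ! l} \<in> E) = (l = Suc k \<or> k = Suc l)"
    using assms[unfolded path_like_def] by simp
qed

lemma path_like_connected:
  assumes "path_like E xs"
  shows "induced_connected E (set xs)"
proof (rule induced_connectedI[of _ "xs ! 0"])
  fix v assume "v \<in> set xs"
  then obtain k where k: "k < length xs" "v = xs ! k" by (auto simp: in_set_conv_nth)
  have "(xs ! 0, xs ! k) \<in> {(x, y). x \<in> set xs \<and> y \<in> set xs \<and> {x, y} \<in> E}\<^sup>*"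
    using k(1)
  proof (induction k)
    case (Suc k)
    then have "{xs ! k, xs ! Suc k} \<in> E" using assms unfolding path_like_def by auto
    then have "(xs ! k, xs ! Suc k) \<in> {(x, y). x \<in> set xs \<and> y \<in> set xs \<and> {x, y} \<in> E}"
      using Suc.prems by simp
    with Suc show ?case by (auto intro: rtrancl_into_rtrancl)
  qed simp
  then show "(xs ! 0, v) \<in> {(x, y). x \<in> set xs \<and> y \<in> set xs \<and> {x, y} \<in> E}\<^sup>*" using k(2) by simp
qed

lemma connected_graph_path_like: "path_like E xs \<Longrightarrow> xs \<noteq> [] \<Longrightarrow> connected_graph (set xs) E"
  by unfold_locales (auto intro: path_like_connected)

text \<open>
  Classification by the first uncovered vertex \<open>xs ! i\<close>: the vertices before it are covered, those
  after it are arbitrary, and deleting it separates the two.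
\<close>

lemma weight_open_path_like:
  assumes path: "path_like E xs"
  shows "weight_open E a t (set xs) =
    (\<Sum>i<length xs. weight_cover E a t (set (take i xs)) * weight_all E a t (set (drop (Suc i) xs)))"
proof -
  let ?V = "set xs"
  let ?f = "\<lambda>N. a ^ (card ?V - 1 - card N) * t ^ card N"
  define Z where "Z i = {N \<in> nested_collections E ?V. xs ! i \<notin> \<Union>N \<and> set (take i xs) \<subseteq> \<Union>N}" for i
  have dist: "distinct xs" using path by (simp add: path_like_def)
  have finZ: "finite (Z i)" for i
    unfolding Z_def using finite_nested_collections[of ?V E] by simp
  have "{N \<in> nested_collections E ?V. \<not> ?V \<subseteq> \<Union>N} = (\<Union>i<length xs. Z i)"
  proof (intro subset_antisym subsetI)
    fix N assume N: "N \<in> {N \<in> nested_collections E ?V. \<not> ?V \<subseteq> \<Union>N}"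
    let ?Q = "\<lambda>i. i < length xs \<and> xs ! i \<notin> \<Union>N"
    obtain x where "x \<in> ?V" "x \<notin> \<Union>N" using N by blast
    then have ex: "\<exists>i. ?Q i" by (metis in_set_conv_nth)
    define i where "i = (LEAST i. ?Q i)"
    have i: "i < length xs" "xs ! i \<notin> \<Union>N" using LeastI_ex[OF ex] by (simp_all add: i_def)
    have least: "\<not> ?Q k" if "k < i" for k using not_less_Least[of k ?Q] that by (simp add: i_def)
    have "set (take i xs) \<subseteq> \<Union>N"
    proof
      fix x assume "x \<in> set (take i xs)"
      then obtain k where "k < i" "k < length xs" "x = xs ! k" by (auto simp: in_set_conv_nth)
      then show "x \<in> \<Union>N" using least[of k] by simp
    qed
    then have "N \<in> Z i" using i N unfolding Z_def by blast
    then show "N \<in> (\<Union>i<length xs. Z i)" using i by blast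
  next
    fix N assume "N \<in> (\<Union>i<length xs. Z i)"
    then obtain i where "i < length xs" "N \<in> Z i" by blast
    then show "N \<in> {N \<in> nested_collections E ?V. \<not> ?V \<subseteq> \<Union>N}"
      using nth_mem[of i xs] unfolding Z_def by blast
  qed
  moreover have "Z i \<inter> Z j = {}" if "i < length xs" "j < length xs" "i \<noteq> j" for i j
  proof -
    have "Z i \<inter> Z j = {}" if "i < j" "j < length xs" for i j
    proof -
      have "xs ! i \<in> set (take j xs)" using that by (auto simp: in_set_conv_nth)
      then have "N \<notin> Z j" if "N \<in> Z i" for N using that unfolding Z_def by fast
      then show ?thesis by blast
    qed
    from this[of i j] this[of j i] show ?thesis using that by (cases i j rule: linorder_cases) auto
  qed
  ultimately have "weight_open E a t ?V = (\<Sum>i<length xs. \<Sum>N\<in>Z i. ?f N)"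
    unfolding weight_open_def using finZ by (subst sum.UNION_disjoint[symmetric]) auto
  also have "\<dots> = (\<Sum>i<length xs. weight_cover E a t (set (take i xs))
      * weight_all E a t (set (drop (Suc i) xs)))"
  proof (rule sum.cong[OF refl])
    fix i assume "i \<in> {..<length xs}"
    then have i: "i < length xs" by simp
    let ?V1 = "set (take i xs)" and ?V2 = "set (drop (Suc i) xs)"
    note xs = id_take_nth_drop[OF i]
    have d: "distinct (take i xs @ xs ! i # drop (Suc i) xs)" using dist xs by metis
    have "?V = insert (xs ! i) (?V1 \<union> ?V2)" by (subst xs) auto
    moreover have ni: "xs ! i \<notin> ?V1 \<union> ?V2" and disj: "?V1 \<inter> ?V2 = {}" using d by auto
    ultimately have sub: "?V1 \<union> ?V2 \<subseteq> ?V" and V: "?V1 \<union> ?V2 = ?V - {xs ! i}"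
      and card: "card (?V1 \<union> ?V2) = card ?V - 1"
      by auto
    have "N \<in> nested_collections E (?V1 \<union> ?V2) \<longleftrightarrow>
        N \<in> nested_collections E ?V \<and> xs ! i \<notin> \<Union>N" for N
    proof -
      have "N \<in> nested_collections E (?V1 \<union> ?V2) \<longleftrightarrow>
          N \<in> nested_collections E ?V \<and> \<Union>N \<subseteq> ?V1 \<union> ?V2"
        unfolding nested_collections_restrict[OF sub] by simp
      then show ?thesis unfolding V using nested_collectionsD(6)[of N E ?V] by blast
    qed
    then have "Z i = {N \<in> nested_collections E (?V1 \<union> ?V2). ?V1 \<subseteq> \<Union>N}"
      unfolding Z_def by (simp only: conj_assoc)
    moreover have "{u, v} \<notin> E" if "u \<in> ?V1" "v \<in> ?V2" for u v
    proof -
      obtain k l where "u = xs ! k" "k < i" "v = xs ! (Suc i + l)" "Suc i + l < length xs"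
        using \<open>u \<in> ?V1\<close> \<open>v \<in> ?V2\<close> i by (auto simp: in_set_conv_nth)
      then show ?thesis using path unfolding path_like_def by auto
    qed
    ultimately show "(\<Sum>N\<in>Z i. ?f N) = weight_cover E a t ?V1 * weight_all E a t ?V2"
      using weight_disjoint_union[of ?V1 ?V2 E a t] disj card by simp
  qed
  finally show ?thesis .
qed

definition path_weight :: "'r \<Rightarrow> 'r \<Rightarrow> nat \<Rightarrow> 'r :: comm_ring_1" where
  "path_weight a t m = weight_open (path_edges m) a t {1..m}"

definition cover_weight :: "'r \<Rightarrow> 'r \<Rightarrow> nat \<Rightarrow> 'r :: comm_ring_1" where
  "cover_weight a t m = (if m = 0 then 1 else t * path_weight a t m)"

definition all_weight :: "'r \<Rightarrow> 'r \<Rightarrow> nat \<Rightarrow> 'r :: comm_ring_1" where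
  "all_weight a t m = (if m = 0 then 1 else (a + t) * path_weight a t m)"

text \<open>
  The recursion above expresses the weight through shorter paths and mentions only lengths.
\<close>

lemma weight_open_path_like_unique:
  assumes "path_like E xs" "path_like E' ys" "length xs = length ys"
  shows "weight_open E a t (set xs) = weight_open E' a t (set ys)"
  using assms
proof (induction "length xs" arbitrary: xs ys rule: less_induct)
  case less
  have "weight_cover E a t (set (take i xs)) * weight_all E a t (set (drop (Suc i) xs))
      = weight_cover E' a t (set (take i ys)) * weight_all E' a t (set (drop (Suc i) ys))"
    if i: "i < length xs" for i
  proof -
    have "weight_cover E a t (set zs) = weight_cover E' a t (set zs')
        \<and> weight_all E a t (set zs) = weight_all E' a t (set zs')"
      if zs: "path_like E zs" "path_like E' zs'" "length zs = length zs'" "length zs < length xs"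
      for zs zs'
    proof (cases "zs = []")
      case False
      then have "zs' \<noteq> []" using zs(3) by auto
      note g = connected_graph_path_like[OF zs(1) False] connected_graph_path_like[OF zs(2) this]
      show ?thesis
        using less.hyps[OF zs(4,1,2,3)] g[THEN connected_graph.weight_cover_connected]
          g[THEN connected_graph.weight_all_connected] by metis
    qed (use zs(3) in simp)
    from this[of "take i xs" "take i ys"] this[of "drop (Suc i) xs" "drop (Suc i) ys"]
    show ?thesis using i less.prems by (simp add: path_like_take path_like_drop)
  qed
  then show ?case
    using less.prems by (simp add: weight_open_path_like)
qed

lemma path_edge_iff:
  assumes "x \<in> {1..m}" "y \<in> {1..m}"
  shows "{x, y} \<in> path_edges m \<longleftrightarrow> y = Suc x \<or> x = Suc y"
  using assms by (auto simp: path_edges_def doubleton_eq_iff)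

lemma cycle_edge_iff:
  assumes "x \<in> {1..m}" "y \<in> {1..m}"
  shows "{x, y} \<in> cycle_edges m \<longleftrightarrow>
    y = Suc x \<or> x = Suc y \<or> 3 \<le> m \<and> (x = m \<and> y = 1 \<or> x = 1 \<and> y = m)"
  using path_edge_iff[OF assms] by (auto simp: cycle_edges_def doubleton_eq_iff)

lemma path_like_path: "path_like (path_edges m) [1..<Suc m]"
  unfolding path_like_def
proof (intro conjI allI impI)
  fix k l assume "k < length [1..<Suc m]" "l < length [1..<Suc m]"
  then show "({[1..<Suc m] ! k, [1..<Suc m] ! l} \<in> path_edges m) = (l = Suc k \<or> k = Suc l)"
    using path_edge_iff[of "Suc k" m "Suc l"] by (simp add: nth_upt del: upt_Suc)
qed simp

lemma set_upt_path: "set [1..<Suc m] = {1..m}"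
  by (simp add: atLeastLessThanSuc_atLeastAtMost del: upt_Suc)

lemma path_like_weights:
  assumes "path_like E xs"
  shows "weight_open E a t (set xs) = path_weight a t (length xs)"
    and "weight_cover E a t (set xs) = cover_weight a t (length xs)"
    and "weight_all E a t (set xs) = all_weight a t (length xs)"
proof -
  show *: "weight_open E a t (set xs) = path_weight a t (length xs)"
    using weight_open_path_like_unique[OF assms path_like_path[of "length xs"], of a t]
    unfolding path_weight_def set_upt_path by (simp del: upt_Suc)
  show "weight_cover E a t (set xs) = cover_weight a t (length xs)"
    using connected_graph.weight_cover_connected[OF connected_graph_path_like[OF assms], of a t] *
    by (cases "xs = []") (simp_all add: cover_weight_def)
  show "weight_all E a t (set xs) = all_weight a t (length xs)"
    using connected_graph.weight_all_connected[OF connected_graph_path_like[OF assms], of a t] *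
    by (cases "xs = []") (simp_all add: all_weight_def)
qed

lemma path_weight_rec:
  "path_weight a t m = (\<Sum>i<m. cover_weight a t i * all_weight a t (m - 1 - i))"
proof -
  have "path_weight a t m = weight_open (path_edges m) a t (set [1..<Suc m])"
    unfolding path_weight_def set_upt_path ..
  also have "\<dots> = (\<Sum>i<m. cover_weight a t i * all_weight a t (m - 1 - i))"
    unfolding weight_open_path_like[OF path_like_path]
      path_like_weights(2)[OF path_like_take[OF path_like_path]]
      path_like_weights(3)[OF path_like_drop[OF path_like_path]]
    by (rule sum.cong) (simp_all del: upt_Suc)
  finally show ?thesis .
qed

lemma path_like_outer_arc:
  assumes ij: "1 \<le> i" "i \<le> j" "j \<le> m"
  shows "path_like (cycle_edges m) ([Suc j..<Suc m] @ [1..<i])" (is "path_like _ ?xs")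
  unfolding path_like_def
proof (intro conjI allI impI)
  show "distinct ?xs" using ij by auto
  fix k l assume kl: "k < length ?xs" "l < length ?xs"
  have nth: "?xs ! k = (if k < m - j then Suc j + k else Suc (k - (m - j)))"
    if "k < length ?xs" for k
    using that ij by (auto simp: nth_append nth_upt simp del: upt_Suc)
  have len: "length ?xs = (m - j) + (i - 1)" using ij by (simp del: upt_Suc)
  have range: "?xs ! k \<in> {1..m}" if "k < length ?xs" for k
    unfolding nth[OF that] using that ij unfolding len by auto
  show "({?xs ! k, ?xs ! l} \<in> cycle_edges m) = (l = Suc k \<or> k = Suc l)"
    unfolding cycle_edge_iff[OF range[OF kl(1)] range[OF kl(2)]]
    unfolding nth[OF kl(1)] nth[OF kl(2)]
    using kl ij unfolding len by (auto split: if_splits)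
qed

lemma path_like_inner_arc:
  assumes ij: "1 \<le> i" "j \<le> m"
  shows "path_like (cycle_edges m) [Suc i..<j]"
  unfolding path_like_def
proof (intro conjI allI impI)
  fix k l assume "k < length [Suc i..<j]" "l < length [Suc i..<j]"
  then have "Suc i + k < j" "Suc i + l < j" by auto
  then show "({[Suc i..<j] ! k, [Suc i..<j] ! l} \<in> cycle_edges m) = (l = Suc k \<or> k = Suc l)"
    using ij cycle_edge_iff[of "Suc i + k" m "Suc i + l"] by (auto simp: nth_upt)
qed simp

text \<open>
  Classification by the smallest and the largest uncovered vertex \<open>i \<le> j\<close>. Deleting them leaves the
  arc from \<open>j + 1\<close> through \<open>m\<close> and \<open>1\<close> to \<open>i - 1\<close>, which is covered, and the arc between \<open>i\<close> and \<open>j\<close>,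
  which is arbitrary. If \<open>i \<noteq> j\<close>, two vertices disappear instead of one, whence the factor \<open>a\<close>. If \<open>i = j\<close>,
  the inner arc is empty, in accordance with \<open>j - i - 1 = 0\<close> for natural numbers.
\<close>

lemma weight_open_cycle:
  "weight_open (cycle_edges m) a t {1..m} =
    (\<Sum>(i, j)\<in>{(i, j). 1 \<le> i \<and> i \<le> j \<and> j \<le> m}.
       (if i = j then 1 else a) * cover_weight a t (m - 1 - (j - i)) * all_weight a t (j - i - 1))"
proof -
  let ?E = "cycle_edges m" and ?V = "{1..m}"
  let ?J = "{(i, j). 1 \<le> i \<and> i \<le> j \<and> j \<le> m}"
  let ?f = "\<lambda>N. a ^ (card ?V - 1 - card N) * t ^ card N"
  define out where "out i j = {1..<i} \<union> {j<..m}" for i j :: nat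
  define Z where "Z p = {N \<in> nested_collections ?E ?V. fst p \<notin> \<Union>N \<and> snd p \<notin> \<Union>N
    \<and> out (fst p) (snd p) \<subseteq> \<Union>N}" for p
  have finJ: "finite ?J" by (rule finite_subset[of _ "{1..m} \<times> {1..m}"]) auto
  have finZ: "finite (Z p)" for p
    unfolding Z_def using finite_nested_collections[of ?V ?E] by simp
  have "{N \<in> nested_collections ?E ?V. \<not> ?V \<subseteq> \<Union>N} = (\<Union>p\<in>?J. Z p)"
  proof (intro subset_antisym subsetI)
    fix N assume N: "N \<in> {N \<in> nested_collections ?E ?V. \<not> ?V \<subseteq> \<Union>N}"
    define M where "M = ?V - \<Union>N"
    have "finite M" by (simp add: M_def)
    moreover have "M \<noteq> {}" using N unfolding M_def by blast
    ultimately obtain i j where ij: "i \<in> M" "j \<in> M" and bounds: "\<And>x. x \<in> M \<Longrightarrow> i \<le> x \<and> x \<le> j"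
      using Min_in[of M] Max_in[of M] Min_le[of M] Max_ge[of M] by blast
    have "out i j \<subseteq> \<Union>N"
    proof
      fix x assume x: "x \<in> out i j"
      show "x \<in> \<Union>N"
      proof (rule ccontr)
        assume "x \<notin> \<Union>N"
        moreover have "x \<in> ?V" using x ij by (auto simp: out_def M_def)
        ultimately have "x \<in> M" unfolding M_def by blast
        then show False using bounds[of x] x by (auto simp: out_def)
      qed
    qed
    moreover have "i \<notin> \<Union>N" "j \<notin> \<Union>N" "1 \<le> i" "j \<le> m" "i \<le> j"
      using ij bounds[of j] by (auto simp: M_def)
    ultimately have "N \<in> Z (i, j)" "(i, j) \<in> ?J" using N by (auto simp: Z_def)
    then show "N \<in> (\<Union>p\<in>?J. Z p)" by blast
  next
    fix N assume "N \<in> (\<Union>p\<in>?J. Z p)"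
    then obtain p where p: "p \<in> ?J" "N \<in> Z p" by blast
    then have "fst p \<in> ?V" "fst p \<notin> \<Union>N" "N \<in> nested_collections ?E ?V" by (auto simp: Z_def)
    then show "N \<in> {N \<in> nested_collections ?E ?V. \<not> ?V \<subseteq> \<Union>N}" by blast
  qed
  moreover have "Z p \<inter> Z q = {}" if "p \<in> ?J" "q \<in> ?J" "p \<noteq> q" for p q
  proof (rule ccontr)
    assume "Z p \<inter> Z q \<noteq> {}"
    then obtain N where N: "N \<in> Z p" "N \<in> Z q" by blast
    have "fst p \<notin> \<Union>N" "snd p \<notin> \<Union>N" "out (fst p) (snd p) \<subseteq> \<Union>N"
      "fst q \<notin> \<Union>N" "snd q \<notin> \<Union>N" "out (fst q) (snd q) \<subseteq> \<Union>N"
      using N unfolding Z_def by simp_all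
    then have "fst p \<notin> out (fst q) (snd q)" "snd p \<notin> out (fst q) (snd q)"
      "fst q \<notin> out (fst p) (snd p)" "snd q \<notin> out (fst p) (snd p)"
      by (meson subsetD)+
    then have "fst p = fst q \<and> snd p = snd q" using that(1,2) by (auto simp: out_def)
    then show False using that(3) by (simp add: prod_eq_iff)
  qed
  ultimately have "weight_open ?E a t ?V = (\<Sum>p\<in>?J. \<Sum>N\<in>Z p. ?f N)"
    unfolding weight_open_def using finZ finJ by (subst sum.UNION_disjoint[symmetric]) auto
  also have "\<dots> = (\<Sum>(i, j)\<in>?J.
      (if i = j then 1 else a) * cover_weight a t (m - 1 - (j - i)) * all_weight a t (j - i - 1))"
  proof (rule sum.cong[OF refl])
    fix p assume "p \<in> ?J"
    then obtain i j where p: "p = (i, j)" and ij: "1 \<le> i" "i \<le> j" "j \<le> m" by blast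
    let ?O = "[Suc j..<Suc m] @ [1..<i]" and ?I = "[Suc i..<j]"
    have O: "set ?O = out i j" unfolding out_def by auto
    have UV: "set ?O \<union> set ?I = ?V - {i, j}" using ij by auto
    then have sub: "set ?O \<union> set ?I \<subseteq> ?V" by blast
    have disj: "set ?O \<inter> set ?I = {}" using ij by auto
    have "N \<in> nested_collections ?E (set ?O \<union> set ?I) \<longleftrightarrow>
        N \<in> nested_collections ?E ?V \<and> i \<notin> \<Union>N \<and> j \<notin> \<Union>N" for N
    proof -
      have "N \<in> nested_collections ?E (set ?O \<union> set ?I) \<longleftrightarrow>
          N \<in> nested_collections ?E ?V \<and> \<Union>N \<subseteq> set ?O \<union> set ?I"
        unfolding nested_collections_restrict[OF sub] by simp
      then show ?thesis unfolding UV using nested_collectionsD(6)[of N ?E ?V] by blast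
    qed
    then have Zp: "Z p = {N \<in> nested_collections ?E (set ?O \<union> set ?I). set ?O \<subseteq> \<Union>N}"
      unfolding Z_def O p fst_conv snd_conv by (simp only: conj_assoc)
    have sep: "{u, v} \<notin> ?E" if "u \<in> set ?O" "v \<in> set ?I" for u v
    proof -
      have "u \<in> ?V" "v \<in> ?V" using that sub by blast+
      moreover have "u < i \<or> j < u" "i < v" "v < j" using that by auto
      ultimately show ?thesis using cycle_edge_iff[of u m v] ij by auto
    qed
    have card: "card (set ?O \<union> set ?I) = (if i = j then m - 1 else m - 2)"
      unfolding UV using ij by (auto simp: card_Diff_subset)
    have "?f N = (if i = j then 1 else a) *
        (a ^ (card (set ?O \<union> set ?I) - card N) * t ^ card N)" if N: "N \<in> Z p" for N
    proof (cases "i = j")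
      case False
      have N': "N \<in> nested_collections ?E (set ?O \<union> set ?I)" using N unfolding Zp by blast
      have "card N \<le> card (\<Union>N)" by (rule card_nested_le[OF N']) simp
      also have "\<dots> \<le> card (set ?O \<union> set ?I)"
        by (rule card_mono) (use nested_collectionsD(6)[OF N'] in auto)
      also have c: "card (set ?O \<union> set ?I) = m - 2" using card False by simp
      finally have "card ?V - 1 - card N = Suc (m - 2 - card N)" using False ij by simp
      then show ?thesis using False c by (simp add: mult.assoc)
    qed (unfold card, simp)
    then have "(\<Sum>N\<in>Z p. ?f N) = (if i = j then 1 else a) *
        (\<Sum>N\<in>Z p. a ^ (card (set ?O \<union> set ?I) - card N) * t ^ card N)"
      unfolding sum_distrib_left by (rule sum.cong[OF refl])
    also have "\<dots> = (if i = j then 1 else a) * (weight_cover ?E a t (set ?O) * weight_all ?E a t (set ?I))"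
      unfolding Zp by (subst weight_disjoint_union) (use disj sep in auto)
    also have "weight_cover ?E a t (set ?O) = cover_weight a t (m - 1 - (j - i))"
      unfolding path_like_weights(2)[OF path_like_outer_arc[OF ij]] using ij by (simp del: upt_Suc)
    also have "weight_all ?E a t (set ?I) = all_weight a t (j - i - 1)"
      unfolding path_like_weights(3)[OF path_like_inner_arc[OF ij(1,3)]] by simp
    finally show "(\<Sum>N\<in>Z p. ?f N) = (case p of (i, j) \<Rightarrow> (if i = j then 1 else a)
        * cover_weight a t (m - 1 - (j - i)) * all_weight a t (j - i - 1))"
      by (simp add: p mult.assoc)
  qed
  finally show ?thesis .
qed

section \<open>Generating functions\<close>

lemma path_weight_0 [simp]: "path_weight a t 0 = 0"
  by (simp add: path_weight_def)

definition cycle_weight :: "'r \<Rightarrow> 'r \<Rightarrow> nat \<Rightarrow> 'r :: comm_ring_1" where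
  "cycle_weight a t m = weight_open (cycle_edges m) a t {1..m}"

lemma cycle_weight_0 [simp]: "cycle_weight a t 0 = 0"
  by (simp add: cycle_weight_def)

text \<open>
  There are \<open>k + 1 - d\<close> pairs \<open>i \<le> j\<close> in \<open>{1..k + 1}\<close> with \<open>j - i = d\<close>.
\<close>

lemma cycle_weight_Suc:
  "cycle_weight a t (Suc k) =
    (\<Sum>d\<le>k. (if d = 0 then 1 else a * all_weight a t (d - 1)) * (of_nat (Suc (k - d)) * cover_weight a t (k - d)))"
proof -
  let ?h = "\<lambda>d. (if d = 0 then 1 else a * all_weight a t (d - 1)) * cover_weight a t (k - d)"
  let ?J = "{(i, j). 1 \<le> i \<and> i \<le> j \<and> j \<le> Suc k}"
  let ?S = "Sigma {..k} (\<lambda>d. {1..Suc k - d})"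
  have "cycle_weight a t (Suc k) = (\<Sum>(i, j)\<in>?J. ?h (j - i))"
    unfolding cycle_weight_def weight_open_cycle
    by (rule sum.cong) (auto simp: all_weight_def mult_ac)
  also have "\<dots> = (\<Sum>(d, i)\<in>?S. ?h d)"
    by (rule sum.reindex_bij_witness[where i = "\<lambda>(d, i). (i, i + d)" and j = "\<lambda>(i, j). (j - i, i)"]) auto
  also have "\<dots> = (\<Sum>d\<le>k. of_nat (Suc k - d) * ?h d)"
    by (subst sum.Sigma[symmetric]) simp_all
  also have "\<dots> = (\<Sum>d\<le>k. (if d = 0 then 1 else a * all_weight a t (d - 1))
      * (of_nat (Suc (k - d)) * cover_weight a t (k - d)))"
    by (rule sum.cong) (auto simp: Suc_diff_le mult_ac simp del: of_nat_Suc)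
  finally show ?thesis .
qed

text \<open>
  The algebra behind the recursion of the cyclohedra, with \<open>A'\<close> the derivative of the series \<open>A\<close> of the
  paths. The equation for \<open>A\<close> makes \<open>U\<close> the inverse of \<open>1 - s X B\<close>, and differentiating it makes \<open>A'\<close> the
  quotient of \<open>B U\<close> by \<open>Q = 1 - (s + t) X - 2 s t X A\<close>. With these, \<open>C Q\<close> collapses to \<open>X\<close>.
\<close>

lemma cycle_equation:
  fixes A A' B C U X s t :: "'r :: comm_ring_1"
  assumes A: "A = X * (B * U)" and B: "B = 1 + t * A" and U: "U = 1 + s * A"
    and A': "A' = B * U + X * (t * A' * U + B * (s * A'))"
    and C: "C = X * ((B + X * (t * A')) * (1 + (s - t) * X * U))"
  shows "C = X + (s + t) * (X * C) + 2 * s * t * (X * (A * C))"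
proof -
  define Q where "Q = 1 - (s + t) * X - 2 * s * t * X * A"
  have e1: "(1 - s * X * B) * U = 1"
  proof -
    have "(1 - s * X * B) * U = U - s * (X * (B * U))" by (simp add: algebra_simps)
    also have "\<dots> = 1" unfolding A[symmetric] by (simp add: U)
    finally show ?thesis .
  qed
  have e2: "B * (1 + (s - t) * X * U) = U"
  proof -
    have "B * (1 + (s - t) * X * U) = B + s * (X * (B * U)) - t * (X * (B * U))"
      by (simp add: algebra_simps)
    also have "\<dots> = U" unfolding A[symmetric] by (simp add: B U)
    finally show ?thesis .
  qed
  have e3: "A' * Q = B * U"
  proof -
    have "A' * Q = A' - X * (t * A' * (1 + s * A) + (1 + t * A) * (s * A'))"
      by (simp add: Q_def algebra_simps)
    also have "\<dots> = A' - X * (t * A' * U + B * (s * A'))" by (simp only: B[symmetric] U[symmetric])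
    also have "\<dots> = B * U" by (subst A') simp
    finally show ?thesis .
  qed
  have e4: "(B + X * (t * A')) * Q = B * (1 - s * X * B)"
  proof -
    have "(B + X * (t * A')) * Q = B * Q + X * t * (A' * Q)" by (simp add: algebra_simps)
    also have "\<dots> = B * (Q + X * t * U)" unfolding e3 by (simp add: algebra_simps)
    also have "Q + X * t * U = 1 - s * X * (1 + t * A)" unfolding Q_def U by (simp add: algebra_simps)
    finally show ?thesis by (simp only: B[symmetric])
  qed
  have "C * Q = X * (((B + X * (t * A')) * Q) * (1 + (s - t) * X * U))"
    by (subst C) (simp add: mult_ac)
  also have "\<dots> = X * ((1 - s * X * B) * (B * (1 + (s - t) * X * U)))"
    unfolding e4 by (simp add: mult_ac)
  also have "\<dots> = X" unfolding e2 e1 by simp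
  finally have "C * Q = X" .
  moreover have "C = C * Q + (s + t) * (X * C) + 2 * s * t * (X * (A * C))"
    unfolding Q_def by (simp add: algebra_simps)
  ultimately show ?thesis by simp
qed

context
  fixes a t :: "'r :: comm_ring_1"
begin

definition "path_series = Abs_fps (path_weight a t)"
definition "cover_series = Abs_fps (cover_weight a t)"
definition "all_series = Abs_fps (all_weight a t)"
definition "cycle_series = Abs_fps (cycle_weight a t)"

lemma cover_series_eq: "cover_series = 1 + fps_const t * path_series"
  by (rule fps_ext) (simp add: cover_series_def path_series_def cover_weight_def)

lemma all_series_eq: "all_series = 1 + fps_const (a + t) * path_series"
  by (rule fps_ext) (simp add: all_series_def path_series_def all_weight_def del: fps_const_add)

lemma path_series_eq: "path_series = fps_X * (cover_series * all_series)"
proof (rule fps_ext)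
  fix n
  show "fps_nth path_series (n) = fps_nth (fps_X * (cover_series * all_series)) (n)"
  proof (cases n)
    case (Suc k)
    have "fps_nth (fps_X * (cover_series * all_series)) (Suc k) = fps_nth (cover_series * all_series) k"
      by simp
    also have "\<dots> = path_weight a t (Suc k)"
      by (simp add: cover_series_def all_series_def fps_mult_nth
          path_weight_rec[of a t "Suc k"] lessThan_Suc_atMost atLeast0AtMost)
    finally show ?thesis using Suc by (simp add: path_series_def)
  qed (simp add: path_series_def)
qed

text \<open>
  The derivative supplies the multiplicities: the coefficient of \<open>(X B)'\<close> at \<open>k\<close> is \<open>k + 1\<close> times that
  of \<open>B\<close>.
\<close>

lemma cycle_series_eq:
  "cycle_series = fps_X * (fps_deriv (fps_X * cover_series) * (1 + fps_const a * fps_X * all_series))"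
proof (rule fps_ext)
  fix n
  let ?D = "fps_deriv (fps_X * cover_series)" and ?G = "1 + fps_const a * fps_X * all_series"
  have D: "fps_nth ?D (k) = of_nat (Suc k) * cover_weight a t k" for k
    by (cases k) (simp_all add: cover_series_def algebra_simps)
  have G: "fps_nth ?G (k) = (if k = 0 then 1 else a * all_weight a t (k - 1))" for k
    by (simp add: all_series_def mult.assoc)
  show "fps_nth cycle_series (n) = fps_nth (fps_X * (?D * ?G)) (n)"
  proof (cases n)
    case (Suc k)
    have "fps_nth (fps_X * (?D * ?G)) (Suc k) = fps_nth (?G * ?D) (k)" by (simp add: mult.commute del: fps_deriv_mult)
    also have "\<dots> = cycle_weight a t (Suc k)"
      unfolding cycle_weight_Suc fps_mult_nth G D atLeast0AtMost ..
    finally show ?thesis using Suc by (simp add: cycle_series_def)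
  qed (simp add: cycle_series_def)
qed

text \<open>
  With \<open>a = \<alpha> - t\<close> the coefficient \<open>a + t\<close> becomes \<open>\<alpha>\<close>, so the substitution that turns F into H is
  what makes this equation symmetric in \<open>\<alpha>\<close> and \<open>t\<close>.
\<close>

lemma path_series_recursion:
  "path_series = fps_X + fps_const (a + t + t) * (fps_X * path_series)
     + fps_const ((a + t) * t) * (fps_X * (path_series * path_series))"
proof -
  let ?s = "fps_const (a + t)" and ?t = "fps_const t" and ?A = path_series
  have "?A = fps_X * ((1 + ?t * ?A) * (1 + ?s * ?A))"
    using path_series_eq unfolding cover_series_eq all_series_eq .
  also have "\<dots> = fps_X + (?s + ?t) * (fps_X * ?A) + (?s * ?t) * (fps_X * (?A * ?A))"
    by (simp add: algebra_simps del: fps_const_add fps_const_mult)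
  finally show ?thesis by simp
qed

lemma cycle_series_recursion:
  "cycle_series = fps_X + fps_const (a + t + t) * (fps_X * cycle_series)
     + fps_const (2 * (a + t) * t) * (fps_X * (path_series * cycle_series))"
proof -
  let ?s = "fps_const (a + t)" and ?t = "fps_const t" and ?A = path_series
    and ?B = cover_series and ?U = all_series and ?X = "fps_X :: 'r fps"
  have B': "fps_deriv ?B = ?t * fps_deriv ?A" and U': "fps_deriv ?U = ?s * fps_deriv ?A"
    by (simp_all add: cover_series_eq all_series_eq)
  have A': "fps_deriv ?A = ?B * ?U + ?X * (?t * fps_deriv ?A * ?U + ?B * (?s * fps_deriv ?A))"
    by (subst (1) path_series_eq) (simp add: B' U' algebra_simps)
  have "fps_deriv (?X * ?B) = ?B + ?X * (?t * fps_deriv ?A)"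
    by (simp add: B' algebra_simps)
  moreover have "fps_const a = ?s - ?t" by simp
  ultimately have C: "cycle_series
      = ?X * ((?B + ?X * (?t * fps_deriv ?A)) * (1 + (?s - ?t) * ?X * ?U))"
    using cycle_series_eq by metis
  have "cycle_series = ?X + (?s + ?t) * (?X * cycle_series) + 2 * ?s * ?t * (?X * (?A * cycle_series))"
    by (rule cycle_equation[OF path_series_eq cover_series_eq all_series_eq A' C])
  then show ?thesis by (simp add: fps_numeral_fps_const)
qed

lemma path_weight_recursion:
  "path_weight a t (Suc 0) = 1"
  "1 \<le> n \<Longrightarrow> path_weight a t (Suc n) = (a + t + t) * path_weight a t n
     + (a + t) * t * (\<Sum>i=1..n - 1. path_weight a t i * path_weight a t (n - i))"
proof -
  have nth: "fps_nth path_series (Suc n) = fps_nth fps_X (Suc n) + (a + t + t) * fps_nth path_series (n)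
      + (a + t) * t * fps_nth (path_series * path_series) (n)" for n
    by (subst path_series_recursion) (simp add: del: fps_const_add fps_const_mult)
  show "path_weight a t (Suc 0) = 1"
    using nth[of 0] by (simp add: path_series_def)
  assume n: "1 \<le> n"
  have "fps_nth (path_series * path_series) (n)
      = (\<Sum>i=0..n. path_weight a t i * path_weight a t (n - i))"
    by (simp add: fps_mult_nth path_series_def)
  also have "\<dots> = (\<Sum>i=1..n - 1. path_weight a t i * path_weight a t (n - i))"
    by (rule sum.mono_neutral_right) (auto simp: le_Suc_eq Suc_le_eq)
  finally show "path_weight a t (Suc n) = (a + t + t) * path_weight a t n
     + (a + t) * t * (\<Sum>i=1..n - 1. path_weight a t i * path_weight a t (n - i))"
    using nth[of n] n by (simp add: path_series_def)
qed

lemma cycle_weight_recursion: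
  "cycle_weight a t (Suc 0) = 1"
  "1 \<le> n \<Longrightarrow> cycle_weight a t (Suc n) = (a + t + t) * cycle_weight a t n
     + 2 * (a + t) * t * (\<Sum>i=1..n - 1. path_weight a t i * cycle_weight a t (n - i))"
proof -
  have nth: "fps_nth cycle_series (Suc n) = fps_nth fps_X (Suc n) + (a + t + t) * fps_nth cycle_series (n)
      + 2 * (a + t) * t * fps_nth (path_series * cycle_series) (n)" for n
    by (subst cycle_series_recursion) (simp add: del: fps_const_add fps_const_mult)
  show "cycle_weight a t (Suc 0) = 1"
    using nth[of 0] by (simp add: cycle_series_def path_series_def)
  assume n: "1 \<le> n"
  have "fps_nth (path_series * cycle_series) (n)
      = (\<Sum>i=0..n. path_weight a t i * cycle_weight a t (n - i))"
    by (simp add: fps_mult_nth path_series_def cycle_series_def)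
  also have "\<dots> = (\<Sum>i=1..n - 1. path_weight a t i * cycle_weight a t (n - i))"
    by (rule sum.mono_neutral_right) (auto simp: le_Suc_eq Suc_le_eq)
  finally show "cycle_weight a t (Suc n) = (a + t + t) * cycle_weight a t n
     + 2 * (a + t) * t * (\<Sum>i=1..n - 1. path_weight a t i * cycle_weight a t (n - i))"
    using nth[of n] n by (simp add: cycle_series_def)
qed

end

lemma connected_graph_path: "connected_graph {1..Suc n} (path_edges (Suc n))"
  using connected_graph_path_like[OF path_like_path[of "Suc n"]] unfolding set_upt_path by simp

lemma connected_graph_cycle: "connected_graph {1..Suc n} (cycle_edges (Suc n))"
proof -
  interpret path: connected_graph "{1..Suc n}" "path_edges (Suc n)" by (rule connected_graph_path)
  have "induced_connected (cycle_edges (Suc n)) {1..Suc n}"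
    unfolding induced_connected_def
  proof (intro ballI)
    fix u v assume "u \<in> {1..Suc n}" "v \<in> {1..Suc n}"
    then have "(u, v) \<in> {(x, y). x \<in> {1..Suc n} \<and> y \<in> {1..Suc n} \<and> {x, y} \<in> path_edges (Suc n)}\<^sup>*"
      using path.connected_V unfolding induced_connected_def by blast
    then show "(u, v) \<in> {(x, y). x \<in> {1..Suc n} \<and> y \<in> {1..Suc n} \<and> {x, y} \<in> cycle_edges (Suc n)}\<^sup>*"
      by (rule rtrancl_mono[THEN subsetD, rotated]) (auto simp: cycle_edges_def)
  qed
  then show ?thesis by unfold_locales auto
qed

lemma associahedron_weight:
  "affine_dimension (associahedron n) = n"
  "F_poly (associahedron n) a t = path_weight a t (Suc n)"
  using connected_graph.affine_dimension_P[OF connected_graph_path]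
    connected_graph.F_poly_eq_weight_open[OF connected_graph_path]
  by (simp_all add: associahedron_def path_weight_def)

lemma cyclohedron_weight:
  "affine_dimension (cyclohedron n) = n"
  "F_poly (cyclohedron n) a t = cycle_weight a t (Suc n)"
  using connected_graph.affine_dimension_P[OF connected_graph_cycle]
    connected_graph.F_poly_eq_weight_open[OF connected_graph_cycle]
  by (simp_all add: cyclohedron_def cycle_weight_def)

section \<open>Gamma polynomials\<close>

definition gamma_expansion :: "nat \<Rightarrow> int poly \<Rightarrow> int poly poly" where
  "gamma_expansion d g = (\<Sum>i\<le>d div 2. of_int (coeff g i) * (var_alpha * var_t) ^ i
      * (var_alpha + var_t) ^ (d - 2 * i))"

text \<open>
  Saying that \<open>g\<close> is a gamma polynomial of a form \<open>h\<close> of degree \<open>d\<close>, independently of any polytope, lets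
  gamma polynomials be computed along the recursions for H.
\<close>

definition has_gamma :: "nat \<Rightarrow> int poly poly \<Rightarrow> int poly \<Rightarrow> bool" where
  "has_gamma d h g \<longleftrightarrow> degree g \<le> d div 2 \<and> h = gamma_expansion d g"

lemma gamma_expansion_add:
  "gamma_expansion d (g + g') = gamma_expansion d g + gamma_expansion d g'"
  by (simp add: gamma_expansion_def distrib_right sum.distrib)

lemma gamma_expansion_0 [simp]: "gamma_expansion d 0 = 0"
  by (simp add: gamma_expansion_def)

lemma has_gamma_add: "has_gamma d h g \<Longrightarrow> has_gamma d h' g' \<Longrightarrow> has_gamma d (h + h') (g + g')"
  by (auto simp: has_gamma_def gamma_expansion_add degree_add_le)

lemma has_gamma_sum:
  assumes "\<And>i. i \<in> I \<Longrightarrow> has_gamma d (h i) (g i)"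
  shows "has_gamma d (\<Sum>i\<in>I. h i) (\<Sum>i\<in>I. g i)"
proof -
  have zero: "has_gamma d 0 0" by (simp add: has_gamma_def)
  show ?thesis using assms
    by (induction I rule: infinite_finite_induct) (auto simp: zero intro: has_gamma_add)
qed

text \<open>
  Both sides are the sum of the terms \<open>f i j\<close> over all \<open>i + j \<le> (d + d') div 2\<close>, as the degree bounds
  make the terms outside the rectangle vanish.
\<close>

lemma has_gamma_mult:
  assumes "has_gamma d h g" "has_gamma d' h' g'"
  shows "has_gamma (d + d') (h * h') (g * g')"
proof -
  let ?x = "var_alpha * var_t" and ?y = "var_alpha + var_t"
  let ?K = "(d + d') div 2"
  have deg: "degree g \<le> d div 2" "degree g' \<le> d' div 2"
    using assms by (auto simp: has_gamma_def)
  define f where "f i j = of_int (coeff g i * coeff g' j) * ?x ^ (i + j) * ?y ^ (d + d' - 2 * (i + j))"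
    for i j
  have "h * h' = (\<Sum>(i, j)\<in>{..d div 2} \<times> {..d' div 2}. f i j)"
  proof -
    have "h * h' = (\<Sum>i\<le>d div 2. \<Sum>j\<le>d' div 2. (of_int (coeff g i) * ?x ^ i * ?y ^ (d - 2 * i))
        * (of_int (coeff g' j) * ?x ^ j * ?y ^ (d' - 2 * j)))"
      using assms by (simp add: has_gamma_def gamma_expansion_def sum_product)
    also have "\<dots> = (\<Sum>i\<le>d div 2. \<Sum>j\<le>d' div 2. f i j)"
    proof (intro sum.cong refl)
      fix i j assume "i \<in> {..d div 2}" "j \<in> {..d' div 2}"
      then have "d + d' - 2 * (i + j) = (d - 2 * i) + (d' - 2 * j)" by auto
      then show "(of_int (coeff g i) * ?x ^ i * ?y ^ (d - 2 * i))
          * (of_int (coeff g' j) * ?x ^ j * ?y ^ (d' - 2 * j)) = f i j"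
        unfolding f_def by (simp only: power_add of_int_mult mult_ac)
    qed
    finally show ?thesis by (simp add: sum.cartesian_product)
  qed
  also have "\<dots> = (\<Sum>(i, j)\<in>{(i, j). i + j \<le> ?K}. f i j)"
  proof (rule sum.mono_neutral_left)
    show "finite {(i, j). i + j \<le> ?K}"
      by (rule finite_subset[of _ "{..?K} \<times> {..?K}"]) auto
    show "{..d div 2} \<times> {..d' div 2} \<subseteq> {(i, j). i + j \<le> ?K}" by auto
    show "\<forall>p\<in>{(i, j). i + j \<le> ?K} - {..d div 2} \<times> {..d' div 2}. (case p of (i, j) \<Rightarrow> f i j) = 0"
    proof
      fix p assume p: "p \<in> {(i, j). i + j \<le> ?K} - {..d div 2} \<times> {..d' div 2}"
      obtain i j where ij: "p = (i, j)" by (cases p)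
      then have "degree g < i \<or> degree g' < j" using p deg by auto
      then have "coeff g i = 0 \<or> coeff g' j = 0" using coeff_eq_0 by blast
      then show "(case p of (i, j) \<Rightarrow> f i j) = 0" by (auto simp: f_def ij)
    qed
  qed
  also have "\<dots> = (\<Sum>k\<le>?K. \<Sum>i\<le>k. f i (k - i))"
    by (rule sum.triangle_reindex_eq)
  also have "\<dots> = gamma_expansion (d + d') (g * g')"
    unfolding gamma_expansion_def
  proof (rule sum.cong[OF refl])
    fix k
    have "(\<Sum>i\<le>k. f i (k - i)) = (\<Sum>i\<le>k. of_int (coeff g i * coeff g' (k - i))) * ?x ^ k * ?y ^ (d + d' - 2 * k)"
      unfolding f_def sum_distrib_right by (rule sum.cong) auto
    then show "(\<Sum>i\<le>k. f i (k - i)) = of_int (coeff (g * g') k) * ?x ^ k * ?y ^ (d + d' - 2 * k)"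
      by (simp add: coeff_mult)
  qed
  finally have "h * h' = gamma_expansion (d + d') (g * g')" .
  moreover have "degree (g * g') \<le> ?K"
    using degree_mult_le[of g g'] deg by linarith
  ultimately show ?thesis by (simp add: has_gamma_def)
qed

lemma has_gamma_one: "has_gamma 0 1 1"
  by (simp add: has_gamma_def gamma_expansion_def)

lemma has_gamma_sum_vars: "has_gamma 1 (var_alpha + var_t) 1"
  by (simp add: has_gamma_def gamma_expansion_def)

lemma has_gamma_product_vars: "has_gamma 2 (of_int c * (var_alpha * var_t)) [:0, c:]"
  by (simp add: has_gamma_def gamma_expansion_def)

lemma coeff_var_product_power:
  "coeff (((var_alpha * var_t) ^ k) * q) i = (if k \<le> i then [:0, 1:] ^ k * coeff q (i - k) else 0)"
proof -
  have "var_alpha * var_t = monom [:0, 1:] 1"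
    by (simp add: var_alpha_def var_t_def monom_Suc monom_0)
  then have "(var_alpha * var_t) ^ k = monom ([:0, 1:] ^ k) k" by (simp add: monom_power)
  then show ?thesis by (simp add: coeff_monom_mult)
qed

text \<open>
  The coefficient of \<open>\<alpha>\<^sup>i\<close> involves only the entries of \<open>g\<close> up to \<open>i\<close>, and the entry \<open>i\<close> is multiplied by
  \<open>t\<close> to the power \<open>d - i\<close>: the system is triangular.
\<close>

lemma gamma_expansion_eq_0:
  assumes zero: "gamma_expansion d g = 0" and deg: "degree g \<le> d div 2"
  shows "g = 0"
proof -
  have "coeff g i = 0" if "i \<le> d div 2" for i
    using that
  proof (induction i rule: less_induct)
    case (less i)
    have vt: "coeff ((var_alpha + var_t) ^ n) 0 = [:0, 1:] ^ n" for n
      unfolding poly_0_coeff_0[symmetric] by (simp add: var_alpha_def var_t_def)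
    have summand: "coeff (of_int (coeff g k) * (var_alpha * var_t) ^ k * (var_alpha + var_t) ^ (d - 2 * k)) i
        = (if k = i then of_int (coeff g i) * ([:0, 1:] ^ i * [:0, 1:] ^ (d - 2 * i)) else 0)"
      if "k \<in> {..d div 2}" for k
    proof -
      have "coeff (of_int (coeff g k) * (var_alpha * var_t) ^ k * (var_alpha + var_t) ^ (d - 2 * k)) i
          = of_int (coeff g k) * coeff ((var_alpha * var_t) ^ k * (var_alpha + var_t) ^ (d - 2 * k)) i"
        by (simp add: of_int_poly mult.assoc)
      also have "\<dots> = (if k = i then of_int (coeff g i) * ([:0, 1:] ^ i * [:0, 1:] ^ (d - 2 * i)) else 0)"
      proof (cases "k < i")
        case True
        then show ?thesis using less.IH[OF True] less.prems by simp
      next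
        case False
        then show ?thesis unfolding coeff_var_product_power using vt by auto
      qed
      finally show ?thesis .
    qed
    have "0 = coeff (gamma_expansion d g) i" using zero by simp
    also have "\<dots> = (\<Sum>k\<le>d div 2. if k = i then
        of_int (coeff g i) * ([:0, 1:] ^ i * [:0, 1:] ^ (d - 2 * i)) else 0)"
      unfolding gamma_expansion_def coeff_sum by (rule sum.cong[OF refl]) (rule summand)
    also have "\<dots> = of_int (coeff g i) * ([:0, 1:] ^ i * [:0, 1:] ^ (d - 2 * i))"
      using less.prems by simp
    finally show "coeff g i = 0" by auto
  qed
  moreover have "coeff g i = 0" if "\<not> i \<le> d div 2" for i
    using that deg by (intro coeff_eq_0) simp
  ultimately show ?thesis by (intro poly_eqI) (metis coeff_0)
qed

lemma has_gamma_unique: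
  assumes "has_gamma d h g" "has_gamma d h g'"
  shows "g = g'"
proof -
  have "gamma_expansion d (g - g') + gamma_expansion d g' = gamma_expansion d g"
    unfolding gamma_expansion_add[symmetric] by simp
  then have "gamma_expansion d (g - g') = 0" using assms by (simp add: has_gamma_def)
  moreover have "degree (g - g') \<le> d div 2" using assms by (simp add: has_gamma_def degree_diff_le)
  ultimately show ?thesis using gamma_expansion_eq_0 by (metis eq_iff_diff_eq_0)
qed

lemma gamma_poly_eqI:
  assumes "has_gamma (affine_dimension P) (H_poly P) g"
  shows "gamma_poly P = g"
proof -
  have "gamma_poly P = (THE g. has_gamma (affine_dimension P) (H_poly P) g)"
    by (simp add: gamma_poly_def has_gamma_def gamma_expansion_def)
  then show ?thesis using assms has_gamma_unique by (metis the_equality)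
qed

lemma H_associahedron_recursion:
  "H_poly (associahedron 0) = 1"
  "1 \<le> n \<Longrightarrow> H_poly (associahedron n) = (var_alpha + var_t) * H_poly (associahedron (n - 1))
     + var_alpha * var_t * (\<Sum>i = 1..n - 1. H_poly (associahedron (i - 1)) * H_poly (associahedron (n - i - 1)))"
proof -
  show "H_poly (associahedron 0) = 1"
    by (simp add: H_poly_def associahedron_weight path_weight_recursion(1))
  assume n: "1 \<le> n"
  have "(\<Sum>i = 1..n - 1. H_poly (associahedron (i - 1)) * H_poly (associahedron (n - i - 1)))
      = (\<Sum>i=1..n - 1. path_weight (var_alpha - var_t) var_t i * path_weight (var_alpha - var_t) var_t (n - i))"
    by (rule sum.cong) (auto simp: H_poly_def associahedron_weight Suc_diff_Suc)
  then show "H_poly (associahedron n) = (var_alpha + var_t) * H_poly (associahedron (n - 1))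
     + var_alpha * var_t * (\<Sum>i = 1..n - 1. H_poly (associahedron (i - 1)) * H_poly (associahedron (n - i - 1)))"
    using n path_weight_recursion(2)[OF n, of "var_alpha - var_t" var_t]
    by (simp add: H_poly_def associahedron_weight)
qed

lemma H_cyclohedron_recursion:
  "H_poly (cyclohedron 0) = 1"
  "1 \<le> n \<Longrightarrow> H_poly (cyclohedron n) = (var_alpha + var_t) * H_poly (cyclohedron (n - 1))
     + 2 * var_alpha * var_t * (\<Sum>i = 1..n - 1. H_poly (associahedron (i - 1)) * H_poly (cyclohedron (n - i - 1)))"
proof -
  show "H_poly (cyclohedron 0) = 1"
    by (simp add: H_poly_def cyclohedron_weight cycle_weight_recursion(1))
  assume n: "1 \<le> n"
  have "(\<Sum>i = 1..n - 1. H_poly (associahedron (i - 1)) * H_poly (cyclohedron (n - i - 1)))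
      = (\<Sum>i=1..n - 1. path_weight (var_alpha - var_t) var_t i * cycle_weight (var_alpha - var_t) var_t (n - i))"
    by (rule sum.cong) (auto simp: H_poly_def associahedron_weight cyclohedron_weight Suc_diff_Suc)
  then show "H_poly (cyclohedron n) = (var_alpha + var_t) * H_poly (cyclohedron (n - 1))
     + 2 * var_alpha * var_t * (\<Sum>i = 1..n - 1. H_poly (associahedron (i - 1)) * H_poly (cyclohedron (n - i - 1)))"
    using n cycle_weight_recursion(2)[OF n, of "var_alpha - var_t" var_t]
    by (simp add: H_poly_def cyclohedron_weight)
qed

text \<open>
  In degree \<open>n\<close>, the form \<open>\<alpha> + t\<close> has gamma polynomial 1 and \<open>c \<alpha> t\<close> has gamma polynomial \<open>c \<tau>\<close>, and
  gamma polynomials are additive and multiplicative.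
\<close>

lemma has_gamma_recursion:
  assumes n: "1 \<le> n" and last: "has_gamma (n - 1) h g"
    and prod: "\<And>i. 1 \<le> i \<Longrightarrow> i \<le> n - 1 \<Longrightarrow> has_gamma (i - 1) (h1 i) (g1 i) \<and> has_gamma (n - i - 1) (h2 i) (g2 i)"
  shows "has_gamma n ((var_alpha + var_t) * h + of_int c * (var_alpha * var_t) * (\<Sum>i = 1..n - 1. h1 i * h2 i))
           (g + [:0, c:] * (\<Sum>i = 1..n - 1. g1 i * g2 i))"
proof (rule has_gamma_add)
  show "has_gamma n ((var_alpha + var_t) * h) g"
    using has_gamma_mult[OF has_gamma_sum_vars last] n by simp
  have "has_gamma n (\<Sum>i = 1..n - 1. of_int c * (var_alpha * var_t) * (h1 i * h2 i))
      (\<Sum>i = 1..n - 1. [:0, c:] * (g1 i * g2 i))"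
  proof (rule has_gamma_sum)
    fix i assume i: "i \<in> {1..n - 1}"
    then have d: "2 + ((i - 1) + (n - i - 1)) = n" by auto
    have "has_gamma (i - 1) (h1 i) (g1 i)" "has_gamma (n - i - 1) (h2 i) (g2 i)"
      using prod[of i] i by auto
    from has_gamma_mult[OF has_gamma_product_vars[of c] has_gamma_mult[OF this]]
    show "has_gamma n (of_int c * (var_alpha * var_t) * (h1 i * h2 i)) ([:0, c:] * (g1 i * g2 i))"
      unfolding d .
  qed
  then show "has_gamma n (of_int c * (var_alpha * var_t) * (\<Sum>i = 1..n - 1. h1 i * h2 i))
      ([:0, c:] * (\<Sum>i = 1..n - 1. g1 i * g2 i))"
    by (simp only: sum_distrib_left)
qed

text \<open>
  The recursion for H provides a gamma polynomial, so the definite description in \<open>gamma_poly\<close> denotes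
  it.
\<close>

lemma has_gamma_associahedron:
  "has_gamma n (H_poly (associahedron n)) (gamma_poly (associahedron n))"
proof (induction n rule: less_induct)
  case (less n)
  have "\<exists>g. has_gamma n (H_poly (associahedron n)) g"
  proof (cases "n = 0")
    case True
    then show ?thesis using has_gamma_one H_associahedron_recursion(1) by auto
  next
    case False
    then have n: "1 \<le> n" by simp
    have "has_gamma n ((var_alpha + var_t) * H_poly (associahedron (n - 1)) + of_int 1 * (var_alpha * var_t)
        * (\<Sum>i = 1..n - 1. H_poly (associahedron (i - 1)) * H_poly (associahedron (n - i - 1))))
      (gamma_poly (associahedron (n - 1)) + [:0, 1:] *
        (\<Sum>i = 1..n - 1. gamma_poly (associahedron (i - 1)) * gamma_poly (associahedron (n - i - 1))))"
      using n by (intro has_gamma_recursion conjI less.IH) auto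
    then show ?thesis by (auto simp: H_associahedron_recursion(2)[OF n])
  qed
  then obtain g where g: "has_gamma n (H_poly (associahedron n)) g" ..
  then have "gamma_poly (associahedron n) = g"
    by (intro gamma_poly_eqI) (simp add: associahedron_weight(1))
  then show ?case using g by simp
qed

lemma has_gamma_cyclohedron_step:
  assumes n: "1 \<le> n"
    and IH: "\<And>m. m < n \<Longrightarrow> has_gamma m (H_poly (cyclohedron m)) (gamma_poly (cyclohedron m))"
  shows "has_gamma n (H_poly (cyclohedron n))
    (gamma_poly (cyclohedron (n - 1)) + [:0, 2:] *
      (\<Sum>i = 1..n - 1. gamma_poly (associahedron (i - 1)) * gamma_poly (cyclohedron (n - i - 1))))"
proof -
  have "has_gamma n ((var_alpha + var_t) * H_poly (cyclohedron (n - 1)) + of_int 2 * (var_alpha * var_t)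
      * (\<Sum>i = 1..n - 1. H_poly (associahedron (i - 1)) * H_poly (cyclohedron (n - i - 1))))
    (gamma_poly (cyclohedron (n - 1)) + [:0, 2:] *
      (\<Sum>i = 1..n - 1. gamma_poly (associahedron (i - 1)) * gamma_poly (cyclohedron (n - i - 1))))"
    using n by (intro has_gamma_recursion conjI has_gamma_associahedron IH) auto
  then show ?thesis unfolding H_cyclohedron_recursion(2)[OF n] by (simp add: mult.assoc)
qed

lemma has_gamma_cyclohedron:
  "has_gamma n (H_poly (cyclohedron n)) (gamma_poly (cyclohedron n))"
proof (induction n rule: less_induct)
  case (less n)
  have "\<exists>g. has_gamma n (H_poly (cyclohedron n)) g"
  proof (cases "n = 0")
    case True
    then show ?thesis using has_gamma_one H_cyclohedron_recursion(1) by auto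
  next
    case False
    then have "1 \<le> n" by simp
    from has_gamma_cyclohedron_step[OF this less.IH] show ?thesis by blast
  qed
  then obtain g where g: "has_gamma n (H_poly (cyclohedron n)) g" ..
  then have "gamma_poly (cyclohedron n) = g"
    by (intro gamma_poly_eqI) (simp add: cyclohedron_weight(1))
  then show ?case using g by simp
qed

theorem mainTheorem7:
  fixes n :: nat
  assumes "n \<ge> 1"
  shows "gamma_poly (cyclohedron n) =
           gamma_poly (cyclohedron (n - 1))
           + 2 * [:0, 1:] * (\<Sum>i = 1..n - 1.
               gamma_poly (associahedron (i - 1)) * gamma_poly (cyclohedron (n - i - 1)))
       \<and> H_poly (cyclohedron n) =
           (var_alpha + var_t) * H_poly (cyclohedron (n - 1))
           + 2 * var_alpha * var_t * (\<Sum>i = 1..n - 1.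
               H_poly (associahedron (i - 1)) * H_poly (cyclohedron (n - i - 1)))"
proof
  have "2 * [:0, 1:] = [:0, 2 :: int:]" by (simp add: numeral_poly)
  then show "gamma_poly (cyclohedron n) =
           gamma_poly (cyclohedron (n - 1))
           + 2 * [:0, 1:] * (\<Sum>i = 1..n - 1.
               gamma_poly (associahedron (i - 1)) * gamma_poly (cyclohedron (n - i - 1)))"
    using has_gamma_unique[OF has_gamma_cyclohedron
        has_gamma_cyclohedron_step[OF assms has_gamma_cyclohedron]] by simp
qed (rule H_cyclohedron_recursion(2)[OF assms])

end
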